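(* The isomorphism problem for the class of connected circulant graphs of order $p^\ell$ with $p$ prime, $\ell>3$ and vertex degree $\Delta$ smaller than $p$ is in the complexity class $\mathsf{NC}$; that is, given two graphs from this class, it can be decided in $\mathsf{NC}$ whether they are isomorphic.
   Context: Graphs are directed graphs without loops (undirected graphs are the special case of a symmetric edge relation). For a finite group $H$ with neutral element $e$ and $S\subseteq H\setminus\{e\}$, the Cayley graph $\mathrm{Cay}(H,S)$ has vertex set $H$ and edge set $\{(h,sh): h\in H, s\in S\}$. A circulant graph of order $n$ is a Cayley graph over the cyclic group $\mathbb{Z}_n$. $\mathsf{NC}$ is the class of problems solvable by circuits of polylogarithmic depth and polynomial size. *)

theory Defs
  imports
    "HOL-Library.Landau_Symbols"
    "HOL-Computational_Algebra.Primes"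
    "HOL-Algebra.Elementary_Groups"
    "Graph_Theory.Graph_Theory"
begin

section \<open>Cayley graphs and circulant graphs\<close>

definition cayley_digraph :: "('a, 'b) monoid_scheme \<Rightarrow> 'a set \<Rightarrow> 'a pair_pre_digraph" where
  "cayley_digraph H S =
     \<lparr> pverts = carrier H, parcs = {(h, s \<otimes>\<^bsub>H\<^esub> h) | h s. h \<in> carrier H \<and> s \<in> S} \<rparr>"

text \<open>
  Circulant graphs are taken up to isomorphism: the graph is an abstract one, no cyclic labelling
  of its vertices is given.
\<close>

definition circulant :: "nat \<Rightarrow> 'a pair_pre_digraph \<Rightarrow> bool" where
  "circulant n G \<longleftrightarrow>
     (\<exists>S \<subseteq> carrier (integer_mod_group n) - {\<one>\<^bsub>integer_mod_group n\<^esub>}.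
        digraph_iso (with_proj G) (with_proj (cayley_digraph (integer_mod_group n) S)))"

text \<open>
  A Cayley graph \<open>Cay(H,S)\<close> is regular, all its in- and out-degrees being equal to \<open>card S\<close>, so the
  vertex degree is the common out-degree. The library's \<^const>\<open>Digraph_Component.connected\<close> is
  connectedness of the underlying undirected graph.
\<close>

definition conn_circulant_prime_power :: "'a pair_pre_digraph set" where
  "conn_circulant_prime_power =
     {G. \<exists>p l :: nat. Factorial_Ring.prime p \<and> l > 3 \<and> circulant (p ^ l) G \<and>
           Digraph_Component.connected (with_proj G) \<and>
           (\<forall>v \<in> pverts G. out_degree (with_proj G) v < p)}"


section \<open>Boolean circuits and NC\<close>

text \<open>
  A circuit of fan-in at most two is the list of its gates in a topological order; a gate refers to
  its predecessors by their positions in the list, and the last gate is the output.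
\<close>

datatype gate =
    Input nat
  | Konst bool
  | Neg nat
  | Conj nat nat
  | Disj nat nat

type_synonym circuit = "gate list"

text \<open>\<open>wf_gate n i g\<close>: with \<open>n\<close> inputs, \<open>g\<close> may stand at position \<open>i\<close>.\<close>

fun wf_gate :: "nat \<Rightarrow> nat \<Rightarrow> gate \<Rightarrow> bool" where
  "wf_gate n i (Input j) \<longleftrightarrow> j < n"
| "wf_gate n i (Konst b) \<longleftrightarrow> True"
| "wf_gate n i (Neg j) \<longleftrightarrow> j < i"
| "wf_gate n i (Conj j k) \<longleftrightarrow> j < i \<and> k < i"
| "wf_gate n i (Disj j k) \<longleftrightarrow> j < i \<and> k < i"

definition wf_circuit :: "nat \<Rightarrow> circuit \<Rightarrow> bool" where
  "wf_circuit n c \<longleftrightarrow> c \<noteq> [] \<and> (\<forall>i < length c. wf_gate n i (c ! i))"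

fun gate_val :: "bool list \<Rightarrow> bool list \<Rightarrow> gate \<Rightarrow> bool" where
  "gate_val x vs (Input j) = x ! j"
| "gate_val x vs (Konst b) = b"
| "gate_val x vs (Neg j) = (\<not> vs ! j)"
| "gate_val x vs (Conj j k) = (vs ! j \<and> vs ! k)"
| "gate_val x vs (Disj j k) = (vs ! j \<or> vs ! k)"

definition gate_vals :: "circuit \<Rightarrow> bool list \<Rightarrow> bool list" where
  "gate_vals c x = foldl (\<lambda>vs g. vs @ [gate_val x vs g]) [] c"

definition circuit_output :: "circuit \<Rightarrow> bool list \<Rightarrow> bool" where
  "circuit_output c x = last (gate_vals c x)"

text \<open>The depth of a gate is the length of a longest path leading to it.\<close>

fun gate_depth :: "nat list \<Rightarrow> gate \<Rightarrow> nat" where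
  "gate_depth ds (Input j) = 0"
| "gate_depth ds (Konst b) = 0"
| "gate_depth ds (Neg j) = Suc (ds ! j)"
| "gate_depth ds (Conj j k) = Suc (max (ds ! j) (ds ! k))"
| "gate_depth ds (Disj j k) = Suc (max (ds ! j) (ds ! k))"

definition gate_depths :: "circuit \<Rightarrow> nat list" where
  "gate_depths c = foldl (\<lambda>ds g. ds @ [gate_depth ds g]) [] c"

definition circuit_depth :: "circuit \<Rightarrow> nat" where
  "circuit_depth c = Max (set (gate_depths c))"

definition circuit_size :: "circuit \<Rightarrow> nat" where
  "circuit_size c = length c"

text \<open>
  A decision problem is given by its sets of positive and negative instances. Strings that are
  neither (e.g. those that do not encode an admissible input) may be answered arbitrarily.
  NC means: a family of circuits, one for each input length, of polynomial size and polylogarithmic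
  depth. No uniformity condition is imposed on the family.
\<close>

definition decidable_in_NC :: "bool list set \<Rightarrow> bool list set \<Rightarrow> bool" where
  "decidable_in_NC Yes No \<longleftrightarrow>
     (\<exists>C :: nat \<Rightarrow> circuit.
        (\<forall>n. wf_circuit n (C n)) \<and>
        (\<exists>k. (\<lambda>n. real (circuit_size (C n))) \<in> O(\<lambda>n. real n ^ k)) \<and>
        (\<exists>k. (\<lambda>n. real (circuit_depth (C n))) \<in> O(\<lambda>n. ln (real n) ^ k)) \<and>
        (\<forall>x \<in> Yes. circuit_output (C (length x)) x) \<and>
        (\<forall>x \<in> No. \<not> circuit_output (C (length x)) x))"


section \<open>The isomorphism problem for a class of graphs\<close>

text \<open>Input graphs are given on an initial segment of the natural numbers.\<close>

definition input_digraph :: "nat pair_pre_digraph \<Rightarrow> bool" where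
  "input_digraph G \<longleftrightarrow> pair_digraph G \<and> pverts G = {..<card (pverts G)}"

text \<open>
  A graph is encoded by its order in unary, followed by its adjacency matrix, row by row. This code
  is prefix-free, so a pair of graphs, possibly of different orders, is encoded by concatenation.
\<close>

definition encode_digraph :: "nat pair_pre_digraph \<Rightarrow> bool list" where
  "encode_digraph G =
     (let n = card (pverts G)
      in replicate n True @ [False] @ [(u, v) \<in> parcs G. u \<leftarrow> [0..<n], v \<leftarrow> [0..<n]])"

definition iso_instances :: "bool \<Rightarrow> nat pair_pre_digraph set \<Rightarrow> bool list set" where
  "iso_instances b K =
     {encode_digraph G @ encode_digraph H | G H.
        G \<in> K \<and> H \<in> K \<and> input_digraph G \<and> input_digraph H \<and>
        digraph_iso (with_proj G) (with_proj H) = b}"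

definition isomorphism_problem_in_NC :: "nat pair_pre_digraph set \<Rightarrow> bool" where
  "isomorphism_problem_in_NC K \<longleftrightarrow>
     decidable_in_NC (iso_instances True K) (iso_instances False K)"

end

theory Submission
  imports Defs "HOL-Computational_Algebra.Polynomial_Factorial" "HOL-Number_Theory.Cong"
begin

text \<open>
  Within the class, the isomorphism type of a graph is determined by its spectrum, that is, by its
  order \<open>n\<close> and the numbers of closed walks of each length \<open>k \<le> 2 * n\<close>
  (\<open>conn_circulant_iso_iff_closed_walks\<close>). These numbers are the traces of the powers of the
  adjacency matrix, and traces are easily computed in NC.

  Why the spectrum suffices: for \<open>n = p ^ l\<close> and \<open>\<zeta>\<close> a primitive \<open>n\<close>-th root of unity, the
  eigenvalues of \<open>Cay(\<int>\<^sub>n, S)\<close> are \<open>\<lambda>\<^sub>j(S) = \<Sum>s\<in>S. \<zeta> ^ (j * s)\<close>, and the number of closed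
  walks of length \<open>k\<close> is the \<open>k\<close>-th power sum of the eigenvalues. If these power sums agree for \<open>S\<close>
  and \<open>T\<close>, then \<open>\<lambda>\<^sub>1(S) = \<lambda>\<^sub>j(T)\<close> for some \<open>j\<close>. This is a linear relation with integer
  coefficients between powers of \<open>\<zeta>\<close>. As the cyclotomic polynomial \<open>1 + x ^ q + \<dots> + x ^ ((p - 1) * q)\<close>
  with \<open>q = p ^ (l - 1)\<close> is irreducible, the coefficients of such a relation are constant on the
  residue classes modulo \<open>q\<close> (\<open>prime_power_root_relation\<close>). Each class has \<open>p\<close> elements, whereas
  \<open>S\<close> and \<open>T\<close> have fewer than \<open>p\<close>; so all the coefficients vanish and \<open>S = j T\<close>
  (\<open>equal_eigenvalue_imp_multiple\<close>). Connectedness provides an element of \<open>S\<close> that is prime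
  to \<open>p\<close>; hence \<open>j\<close> is prime to \<open>p\<close>, and multiplication by \<open>j\<close> is an isomorphism.

  Why the traces are in NC: all powers of the adjacency matrix up to exponent \<open>2 * n\<close> arise in
  logarithmically many rounds, each of which doubles the exponents by one layer of matrix products.
  The entries are too large for constant depth arithmetic, but it is enough to know them modulo each
  small \<open>m\<close>, because \<open>lcm(1, \<dots>, M) \<ge> 2 ^ (M - 1)\<close> (\<open>eq_if_small_residues_eq\<close>). Residues modulo a
  small \<open>m\<close> are represented in unary, by the \<open>m\<close> bits telling which residue it is, so that an
  arithmetic operation becomes a Boolean formula of logarithmic depth (\<open>slp_bool_of_slp_nat\<close>).
\<close>

section \<open>Relations between roots of unity of prime power order\<close>

text \<open>
  As \<open>p\<^sup>2\<close> does not divide the constant coefficient, one of the factors, say \<open>g\<close>, has a constant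
  coefficient prime to \<open>p\<close>. If \<open>i\<close> is the first position at which \<open>p\<close> does not divide the coefficient of
  the other factor, then \<open>p\<close> does not divide the coefficient of the product at position \<open>i\<close>; so \<open>i\<close> is the degree of the product, and \<open>g\<close> is constant.
\<close>

lemma eisenstein_criterion:
  fixes f g :: "int poly" and p :: int
  assumes p: "Factorial_Ring.prime p"
    and lower: "\<And>i. i < degree (f * g) \<Longrightarrow> p dvd coeff (f * g) i"
    and lead: "\<not> p dvd lead_coeff (f * g)"
    and const: "\<not> p\<^sup>2 dvd coeff (f * g) 0"
  shows "degree f = 0 \<or> degree g = 0"
proof (rule ccontr)
  assume "\<not> (degree f = 0 \<or> degree g = 0)"
  then have deg: "degree f > 0" "degree g > 0" by auto
  then have nz: "f \<noteq> 0" "g \<noteq> 0" by auto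
  have lead': "\<not> p dvd lead_coeff f" "\<not> p dvd lead_coeff g"
    using lead by (auto simp: lead_coeff_mult)
  have key: False
    if fg: "\<And>i. i < degree (f' * g') \<Longrightarrow> p dvd coeff (f' * g') i"
      and lf: "\<not> p dvd lead_coeff f'" and dg: "degree g' > 0" and nz': "f' \<noteq> 0" "g' \<noteq> 0"
      and g0: "\<not> p dvd coeff g' 0" for f' g' :: "int poly"
  proof -
    define i where "i = (LEAST i. \<not> p dvd coeff f' i)"
    have i: "\<not> p dvd coeff f' i" unfolding i_def by (rule LeastI) (rule lf)
    have i_le: "i \<le> degree f'" unfolding i_def by (rule Least_le) (rule lf)
    have below: "p dvd coeff f' j" if "j < i" for j
      using not_less_Least[of j "\<lambda>i. \<not> p dvd coeff f' i"] that unfolding i_def by blast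
    have "coeff (f' * g') i = (\<Sum>j<i. coeff f' j * coeff g' (i - j)) + coeff f' i * coeff g' 0"
      unfolding coeff_mult by (simp add: lessThan_Suc_atMost[symmetric])
    moreover have "p dvd (\<Sum>j<i. coeff f' j * coeff g' (i - j))"
      by (intro dvd_sum) (use below in auto)
    moreover have "\<not> p dvd coeff f' i * coeff g' 0"
      using i g0 p by (simp add: prime_dvd_mult_iff)
    ultimately have "\<not> p dvd coeff (f' * g') i"
      by (simp add: dvd_add_right_iff)
    moreover have "i < degree (f' * g')"
      using i_le dg nz' by (simp add: degree_mult_eq)
    ultimately show False using fg by blast
  qed
  have c0: "coeff (f * g) 0 = coeff f 0 * coeff g 0" by (simp add: coeff_mult)
  have "\<not> (p dvd coeff f 0 \<and> p dvd coeff g 0)"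
    using const unfolding c0 power2_eq_square by (auto intro: mult_dvd_mono)
  then show False
    using key[of f g] key[of g f] lower lead' deg nz by (auto simp: mult.commute)
qed

text \<open>
  For \<open>q = p ^ k\<close> with \<open>p\<close> prime, this is the cyclotomic polynomial of order \<open>p ^ (k + 1)\<close>.
\<close>

definition prime_power_cyclotomic :: "nat \<Rightarrow> nat \<Rightarrow> int poly" where
  "prime_power_cyclotomic p q = (\<Sum>i<p. monom 1 (i * q))"

lemma freshman_dream_poly:
  fixes a b :: "int poly"
  assumes p: "Factorial_Ring.prime (p::nat)"
  shows "[:int p:] dvd (a + b) ^ p - (a ^ p + b ^ p)"
proof -
  have p0: "p > 0" using p by (simp add: prime_gt_0_nat)
  have "(a + b) ^ p = (\<Sum>k\<le>p. of_nat (p choose k) * a ^ k * b ^ (p - k))"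
    by (rule binomial_ring)
  also have "{..p} = insert 0 (insert p {0<..<p})" using p0 by auto
  also have "(\<Sum>k\<in>insert 0 (insert p {0<..<p}). of_nat (p choose k) * a ^ k * b ^ (p - k))
     = b ^ p + a ^ p + (\<Sum>k\<in>{0<..<p}. of_nat (p choose k) * a ^ k * b ^ (p - k))"
    using p0 by simp
  finally have eq: "(a + b) ^ p - (a ^ p + b ^ p)
     = (\<Sum>k\<in>{0<..<p}. of_nat (p choose k) * a ^ k * b ^ (p - k))" by simp
  have "[:int p:] dvd of_nat (p choose k) * a ^ k * b ^ (p - k)" if "k \<in> {0<..<p}" for k
  proof -
    have "p dvd p choose k" using that p by (intro dvd_choose_prime) (auto simp: not_le)
    then have "(of_nat p :: int poly) dvd of_nat (p choose k)" by (auto elim!: dvdE)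
    then have "(of_nat p :: int poly) dvd of_nat (p choose k) * a ^ k * b ^ (p - k)"
      by (intro dvd_mult2)
    then show ?thesis unfolding of_nat_poly by simp
  qed
  then show ?thesis unfolding eq by (intro dvd_sum) auto
qed

lemma diff_dvd_power_diff: "(a - b :: 'a :: comm_ring_1) dvd a ^ n - b ^ n"
  by (metis dvd_triv_left power_diff_sumr2)

lemma one_plus_X_power_prime_power:
  assumes p: "Factorial_Ring.prime (p::nat)"
  shows "[:int p:] dvd [:1, 1:] ^ (p ^ k) - (1 + monom 1 (p ^ k))"
proof (induction k)
  case 0
  show ?case by (simp add: monom_altdef one_pCons)
next
  case (Suc k)
  let ?A = "[:1, 1:] ^ (p ^ k) :: int poly" and ?B = "1 + monom 1 (p ^ k) :: int poly"
  have "[:int p:] dvd ?A ^ p - ?B ^ p"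
    using Suc.IH diff_dvd_power_diff dvd_trans by blast
  moreover have "[:int p:] dvd ?B ^ p - (1 ^ p + monom 1 (p ^ k) ^ p)"
    by (rule freshman_dream_poly[OF p])
  ultimately have "[:int p:] dvd (?A ^ p - ?B ^ p) + (?B ^ p - (1 ^ p + monom 1 (p ^ k) ^ p))"
    by (rule dvd_add)
  then show ?case
    by (simp add: power_mult[symmetric] mult.commute monom_power algebra_simps)
qed

lemma pcompose_power: "pcompose (f ^ n) g = pcompose f g ^ n" for f g :: "'a :: comm_ring_1 poly"
  by (induction n) (simp_all add: pcompose_mult pcompose_1)

text \<open>
  Modulo \<open>p\<close>, the substitution \<open>x = 1 + y\<close> turns \<open>x ^ q\<close> into \<open>1 + z\<close> with \<open>z = y ^ q\<close>, and
  \<open>z * (\<Sum>i<p. (1 + z) ^ i) = (1 + z) ^ p - 1\<close> is congruent to \<open>z ^ p\<close>. This is what makes the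
  Eisenstein criterion applicable to the shifted polynomial.
\<close>

lemma coeff_prime_power_cyclotomic_shift:
  assumes p: "Factorial_Ring.prime (p::nat)" and q: "q = p ^ k"
  shows "[:int p:] dvd pcompose (prime_power_cyclotomic p q) [:1, 1:] - monom 1 (q * (p - 1))"
proof -
  define y where "y = ([:1, 1:] :: int poly)"
  define z where "z = (monom 1 q :: int poly)"
  have p0: "p > 0" using p by (simp add: prime_gt_0_nat)
  have q0: "q > 0" using p0 q by simp
  have z0: "z \<noteq> 0" by (simp add: z_def)
  have comp: "pcompose (prime_power_cyclotomic p q) y = (\<Sum>i<p. (y ^ q) ^ i)"
    unfolding prime_power_cyclotomic_def
    by (simp add: pcompose_sum monom_altdef pcompose_power pcompose_pCons mult.commute
        flip: power_mult)
  have yq: "[:int p:] dvd y ^ q - (1 + z)"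
    using one_plus_X_power_prime_power[OF p, of k] by (simp add: y_def z_def q)
  have "[:int p:] dvd (\<Sum>i<p. (y ^ q) ^ i - (1 + z) ^ i)"
    by (intro dvd_sum) (rule dvd_trans[OF yq diff_dvd_power_diff])
  then have 1: "[:int p:] dvd (\<Sum>i<p. (y ^ q) ^ i) - (\<Sum>i<p. (1 + z) ^ i)"
    by (simp add: sum_subtractf)
  have geo: "z * (\<Sum>i<p. (1 + z) ^ i) = (1 + z) ^ p - 1"
    using power_diff_1_eq[of "1 + z" p] by simp
  have "[:int p:] dvd (1 + z) ^ p - (1 ^ p + z ^ p)" by (rule freshman_dream_poly[OF p])
  then have "[:int p:] dvd z * ((\<Sum>i<p. (1 + z) ^ i) - z ^ (p - 1))"
    using p0 by (simp add: right_diff_distrib geo diff_diff_eq flip: power_Suc)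
  then have "int p dvd coeff (z * ((\<Sum>i<p. (1 + z) ^ i) - z ^ (p - 1))) (q + i)" for i
    unfolding const_poly_dvd_iff by blast
  then have 2: "[:int p:] dvd (\<Sum>i<p. (1 + z) ^ i) - z ^ (p - 1)"
    unfolding z_def const_poly_dvd_iff coeff_monom_mult by simp
  have "[:int p:] dvd (\<Sum>i<p. (y ^ q) ^ i) - z ^ (p - 1)"
    using dvd_add[OF 1 2] by simp
  then show ?thesis using comp by (simp add: y_def z_def monom_power mult.commute)
qed

lemma degree_prime_power_cyclotomic:
  assumes "p > 0" "q > 0"
  shows "degree (prime_power_cyclotomic p q) = q * (p - 1)"
    and "lead_coeff (prime_power_cyclotomic p q) = 1"
proof -
  have c: "coeff (prime_power_cyclotomic p q) (j * q) = (if j < p then 1 else 0)" for j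
    using assms by (simp add: prime_power_cyclotomic_def coeff_sum)
  have "degree (prime_power_cyclotomic p q) \<le> q * (p - 1)"
    unfolding prime_power_cyclotomic_def
    by (rule degree_sum_le) (auto intro!: order.trans[OF degree_monom_le])
  moreover have "coeff (prime_power_cyclotomic p q) (q * (p - 1)) = 1"
    using c[of "p - 1"] assms by (simp add: mult.commute)
  ultimately show "degree (prime_power_cyclotomic p q) = q * (p - 1)"
    by (metis le_antisym le_degree zero_neq_one)
  then show "lead_coeff (prime_power_cyclotomic p q) = 1"
    using c[of "p - 1"] assms by (simp add: mult.commute)
qed

lemma prime_power_cyclotomic_factor:
  fixes f g :: "int poly"
  assumes p: "Factorial_Ring.prime (p::nat)" and q: "q = p ^ k"
    and fg: "prime_power_cyclotomic p q = f * g"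
  shows "degree f = 0 \<or> degree g = 0"
proof -
  let ?Q = "prime_power_cyclotomic p q" and ?s = "\<lambda>f :: int poly. pcompose f [:1, 1:]"
  have p1: "p > 1" using p by (rule prime_gt_1_nat)
  then have q0: "q > 0" using q by simp
  have deg: "degree (?s ?Q) = q * (p - 1)"
    using degree_prime_power_cyclotomic(1)[of p q] p1 q0 by (simp add: degree_pcompose)
  have cong: "int p dvd coeff (?s ?Q) i - (if i = q * (p - 1) then 1 else 0)" for i
    using coeff_prime_power_cyclotomic_shift[OF p q]
    unfolding const_poly_dvd_iff by (auto dest: spec[of _ i])
  have "degree (?s f) = 0 \<or> degree (?s g) = 0"
  proof (rule eisenstein_criterion[of "int p"])
    show "Factorial_Ring.prime (int p)" using p by simp
    show "int p dvd coeff (?s f * ?s g) i" if "i < degree (?s f * ?s g)" for i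
      using cong[of i] that deg by (simp add: fg pcompose_mult split: if_splits)
    have "lead_coeff (?s ?Q) = 1"
      using degree_prime_power_cyclotomic(2)[of p q] p1 q0
      by (subst lead_coeff_comp) auto
    then show "\<not> int p dvd lead_coeff (?s f * ?s g)"
      using p1 by (simp add: fg pcompose_mult)
    \<comment> \<open>The shifted polynomial has constant coefficient \<open>p\<close>, its value being \<open>p\<close> at \<open>x = 1\<close>.\<close>
    have "coeff (?s ?Q) 0 = poly ?Q 1" by (simp add: pcompose_coeff_0)
    also have "\<dots> = int p" by (simp add: prime_power_cyclotomic_def poly_sum poly_monom)
    finally have "coeff (?s f * ?s g) 0 = int p" by (simp add: fg pcompose_mult)
    then show "\<not> (int p)\<^sup>2 dvd coeff (?s f * ?s g) 0"
      using p1 by (auto simp: power2_eq_square zdvd_imp_le dest!: zdvd_imp_le)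
  qed
  then show ?thesis by (simp add: degree_pcompose)
qed

definition ipoly :: "int poly \<Rightarrow> complex \<Rightarrow> complex" where
  "ipoly f x = poly (map_poly of_int f) x"

lemma ipoly_simps:
  "ipoly (f * g) x = ipoly f x * ipoly g x"
  "ipoly (f + g) x = ipoly f x + ipoly g x"
  "ipoly (smult c f) x = of_int c * ipoly f x"
  "ipoly (monom c i) x = of_int c * x ^ i"
  "ipoly 0 x = 0"
proof -
  have "map_poly complex_of_int (f * g) = map_poly of_int f * map_poly of_int g"
    by (rule poly_eqI) (simp add: coeff_map_poly coeff_mult)
  then show "ipoly (f * g) x = ipoly f x * ipoly g x" by (simp add: ipoly_def)
  have "map_poly complex_of_int (f + g) = map_poly of_int f + map_poly of_int g"
    by (rule poly_eqI) (simp add: coeff_map_poly)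
  then show "ipoly (f + g) x = ipoly f x + ipoly g x" by (simp add: ipoly_def)
  have "map_poly complex_of_int (smult c f) = smult (of_int c) (map_poly of_int f)"
    by (rule poly_eqI) (simp add: coeff_map_poly)
  then show "ipoly (smult c f) x = of_int c * ipoly f x" by (simp add: ipoly_def)
  have "map_poly complex_of_int (monom c i) = monom (of_int c) i"
    by (rule poly_eqI) (simp add: coeff_map_poly)
  then show "ipoly (monom c i) x = of_int c * x ^ i" by (simp add: ipoly_def poly_monom)
qed (simp add: ipoly_def)

lemma ipoly_sum: "ipoly (\<Sum>i\<in>A. f i) x = (\<Sum>i\<in>A. ipoly (f i) x)"
  by (induction A rule: infinite_finite_induct) (simp_all add: ipoly_simps)

text \<open>
  A primitive integer polynomial of least degree with root \<open>w\<close> divides the cyclotomic polynomial over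
  the rationals, by division with remainder, hence over the integers, by Gauss' lemma on contents.
  Since the cyclotomic polynomial has no proper factors, the degrees agree.
\<close>

lemma prime_power_cyclotomic_minimal:
  assumes p: "Factorial_Ring.prime (p::nat)" and q: "q = p ^ k"
    and w: "ipoly (prime_power_cyclotomic p q) w = 0"
    and f: "f \<noteq> 0" "ipoly f w = 0"
  shows "q * (p - 1) \<le> degree f"
proof -
  let ?Q = "prime_power_cyclotomic p q"
  have p1: "p > 1" using p by (rule prime_gt_1_nat)
  then have q0: "q > 0" using q by simp
  note Q = degree_prime_power_cyclotomic[of p q]
  define P where "P = (\<lambda>d. \<exists>f. f \<noteq> 0 \<and> ipoly f w = 0 \<and> degree f = d)"
  have "P (degree f)" using f unfolding P_def by blast
  then have "P (LEAST d. P d)" by (rule LeastI)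
  then obtain h0 where h0: "h0 \<noteq> 0" "ipoly h0 w = 0" "degree h0 = (LEAST d. P d)"
    unfolding P_def by blast
  have min: "degree h0 \<le> degree r" if "r \<noteq> 0" "ipoly r w = 0" for r
    unfolding h0(3) by (rule Least_le) (use that P_def in blast)
  define h where "h = primitive_part h0"
  have h: "h \<noteq> 0" "degree h = degree h0" "content h = 1"
    using h0(1) by (simp_all add: h_def)
  have "ipoly h0 w = of_int (content h0) * ipoly h w"
    unfolding h_def by (metis content_times_primitive_part ipoly_simps(3))
  then have hw: "ipoly h w = 0" using h0 by simp
  \<comment> \<open>The remainder has the root \<open>w\<close> and a degree less than that of \<open>h\<close>, hence vanishes.\<close>
  obtain s r where sr: "pseudo_divmod ?Q h = (s, r)" by fastforce
  define c where "c = lead_coeff h ^ (Suc (degree ?Q) - degree h)"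
  have c0: "c \<noteq> 0" using h(1) by (simp add: c_def)
  have eq: "smult c ?Q = h * s + r" and r: "r = 0 \<or> degree r < degree h"
    using pseudo_divmod[OF h(1) sr] by (auto simp: c_def)
  have "ipoly r w = 0"
    using arg_cong[OF eq, of "\<lambda>f. ipoly f w"] hw w by (simp add: ipoly_simps)
  then have "r = 0" using r min[of r] h(2) by (cases "r = 0") auto
  then have eq': "smult c ?Q = h * s" using eq by simp
  have "content (smult c ?Q) = content (h * s)" by (simp only: eq')
  then have "c dvd content s" by (simp add: content_mult h) (metis abs_dvd_iff dvd_triv_left)
  then obtain s' where s': "s = smult c s'"
    using const_poly_dvd_iff_dvd_content by (metis dvdE mult_pCons_left mult_zero_left add_0_right pCons_0_0)
  then have fac: "?Q = h * s'" using eq' c0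
    by (metis mult_smult_right smult_cancel)
  have "degree h = 0 \<or> degree s' = 0"
    by (rule prime_power_cyclotomic_factor[OF p q fac])
  moreover have "degree h \<noteq> 0"
  proof
    assume "degree h = 0"
    then obtain a where a: "h = [:a:]" by (elim degree_eq_zeroE)
    then show False using hw h(1) by (simp add: ipoly_def map_poly_pCons)
  qed
  ultimately have "degree s' = 0" by simp
  moreover have "s' \<noteq> 0" using fac Q p1 q0 by fastforce
  ultimately have "degree ?Q = degree h" using fac h by (simp add: degree_mult_eq)
  then show ?thesis using min[OF f] h Q p1 q0 by simp
qed

text \<open>
  Subtracting a multiple of \<open>w ^ r * (\<Sum>i<p. w ^ (i * q)) = 0\<close> for each \<open>r < q\<close> annihilates the
  coefficients at the last \<open>q\<close> positions. What remains is a relation of degree less than that of the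
  cyclotomic polynomial, hence trivial.
\<close>

lemma prime_power_root_relation:
  fixes a :: "nat \<Rightarrow> int" and w :: complex
  assumes p: "Factorial_Ring.prime (p::nat)" and q: "q = p ^ k"
    and w: "(\<Sum>i<p. w ^ (i * q)) = 0"
    and rel: "(\<Sum>j<p * q. of_int (a j) * w ^ j) = 0"
    and j: "j < p * q"
  shows "a j = a (j mod q + (p - 1) * q)"
proof -
  have p1: "p > 1" using p by (rule prime_gt_1_nat)
  then have q0: "q > 0" using q by simp
  define b where "b = (\<lambda>j. a j - a (j mod q + (p - 1) * q))"
  have pq: "p * q = (p - 1) * q + q" using p1 by (simp add: algebra_simps flip: add_mult_distrib2)
  have b0: "b i = 0" if "(p - 1) * q \<le> i" "i < p * q" for i
  proof -
    have "i = (i - (p - 1) * q) + (p - 1) * q" "i - (p - 1) * q < q" using that pq by auto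
    then have "i mod q + (p - 1) * q = i" by (metis mod_less mod_mult_self1)
    then show ?thesis by (simp add: b_def)
  qed
  have "(\<Sum>j<p * q. of_int (a (j mod q + (p - 1) * q)) * w ^ j)
      = (\<Sum>i<p. \<Sum>j\<in>{i * q..<i * q + q}. of_int (a (j mod q + (p - 1) * q)) * w ^ j)"
    by (rule sum.nat_group[symmetric])
  also have "\<dots> = (\<Sum>i<p. \<Sum>r<q. of_int (a (r + (p - 1) * q)) * w ^ (i * q + r))"
  proof (rule sum.cong[OF refl])
    fix i
    have jq: "j mod q = j - i * q" if "i * q \<le> j" "j < i * q + q" for j
      using that by (metis add_diff_inverse_nat mod_less mod_mult_self3 nat_add_left_cancel_less not_le)
    show "(\<Sum>j\<in>{i * q..<i * q + q}. of_int (a (j mod q + (p - 1) * q)) * w ^ j)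
      = (\<Sum>r<q. of_int (a (r + (p - 1) * q)) * w ^ (i * q + r))"
      by (rule sum.reindex_bij_witness[of _ "\<lambda>r. i * q + r" "\<lambda>j. j - i * q"]) 
         (auto simp: jq)
  qed
  also have "\<dots> = (\<Sum>r<q. \<Sum>i<p. of_int (a (r + (p - 1) * q)) * w ^ (i * q + r))"
    by (rule sum.swap)
  also have "\<dots> = (\<Sum>r<q. of_int (a (r + (p - 1) * q)) * w ^ r * (\<Sum>i<p. w ^ (i * q)))"
    by (simp add: sum_distrib_left sum_distrib_right power_add mult_ac)
  also have "\<dots> = 0" by (simp add: w)
  finally have "(\<Sum>j<p * q. of_int (b j) * w ^ j) = 0"
    using rel by (simp add: b_def left_diff_distrib sum_subtractf)
  also have "(\<Sum>j<p * q. of_int (b j) * w ^ j) = (\<Sum>j<(p - 1) * q. of_int (b j) * w ^ j)"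
    by (rule sum.mono_neutral_right) (use pq b0 in auto)
  finally have sum0: "(\<Sum>j<(p - 1) * q. of_int (b j) * w ^ j) = 0" .
  define f where "f = (\<Sum>j<(p - 1) * q. monom (b j) j)"
  have "ipoly f w = 0" using sum0 by (simp add: f_def ipoly_sum ipoly_simps)
  moreover have "degree f < q * (p - 1)"
    unfolding f_def
    by (rule degree_sum_less) (use p1 q0 in \<open>auto intro!: le_less_trans[OF degree_monom_le] simp: mult.commute\<close>)
  moreover have "ipoly (prime_power_cyclotomic p q) w = 0"
    using w by (simp add: prime_power_cyclotomic_def ipoly_sum ipoly_simps)
  ultimately have f0: "f = 0"
    using prime_power_cyclotomic_minimal[OF p q] by fastforce
  have "b j = 0"
  proof (cases "j < (p - 1) * q")
    case True
    then have "coeff f j = b j" by (simp add: f_def coeff_sum)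
    then show ?thesis using f0 by simp
  qed (use b0 j in auto)
  then show ?thesis by (simp add: b_def)
qed


section \<open>Closed walks\<close>

text \<open>
  The entries of the powers of the adjacency matrix; \<open>closed_walks\<close> is their trace.
\<close>

fun walks :: "'a set \<Rightarrow> ('a \<Rightarrow> 'a \<Rightarrow> bool) \<Rightarrow> nat \<Rightarrow> 'a \<Rightarrow> 'a \<Rightarrow> nat" where
  "walks V E 0 u v = of_bool (u = v)"
| "walks V E (Suc k) u v = (\<Sum>w\<in>V. of_bool (E u w) * walks V E k w v)"

definition closed_walks :: "'a set \<Rightarrow> ('a \<Rightarrow> 'a \<Rightarrow> bool) \<Rightarrow> nat \<Rightarrow> nat" where
  "closed_walks V E k = (\<Sum>u\<in>V. walks V E k u u)"

lemma walks_add: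
  assumes "finite V" "u \<in> V"
  shows "walks V E (a + b) u v = (\<Sum>w\<in>V. walks V E a u w * walks V E b w v)"
  using assms(2)
proof (induction a arbitrary: u)
  case 0
  then show ?case using assms(1) by (simp add: if_distrib[of "\<lambda>x. x * _"] of_bool_def cong: if_cong)
next
  case (Suc a)
  have "walks V E (Suc a + b) u v
      = (\<Sum>x\<in>V. of_bool (E u x) * (\<Sum>w\<in>V. walks V E a x w * walks V E b w v))"
    by (simp add: Suc.IH)
  also have "\<dots> = (\<Sum>w\<in>V. \<Sum>x\<in>V. of_bool (E u x) * walks V E a x w * walks V E b w v)"
    by (subst sum.swap) (simp add: sum_distrib_left mult.assoc)
  also have "\<dots> = (\<Sum>w\<in>V. walks V E (Suc a) u w * walks V E b w v)"
    by (simp add: sum_distrib_right)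
  finally show ?case .
qed

lemma walks_le: "walks V E k u v \<le> card V ^ k"
proof (induction k arbitrary: u)
  case (Suc k)
  have "walks V E (Suc k) u v \<le> (\<Sum>w\<in>V. card V ^ k)"
    unfolding walks.simps by (intro sum_mono) (use Suc.IH in auto)
  then show ?case by simp
qed (simp add: of_bool_def)

lemma closed_walks_le: "closed_walks V E k \<le> card V ^ Suc k"
proof -
  have "closed_walks V E k \<le> (\<Sum>w\<in>V. card V ^ k)"
    unfolding closed_walks_def by (intro sum_mono) (rule walks_le)
  then show ?thesis by simp
qed

lemma closed_walks_iso:
  assumes f: "bij_betw f V V'" and E: "\<And>u v. u \<in> V \<Longrightarrow> v \<in> V \<Longrightarrow> E u v \<longleftrightarrow> E' (f u) (f v)"
  shows "closed_walks V E k = closed_walks V' E' k"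
proof -
  have "walks V E k u v = walks V' E' k (f u) (f v)" if "u \<in> V" "v \<in> V" for u v k
    using that
  proof (induction k arbitrary: u)
    case 0
    then show ?case using f by (auto simp: bij_betw_def inj_on_eq_iff)
  next
    case (Suc k)
    have "(\<Sum>w\<in>V'. of_bool (E' (f u) w) * walks V' E' k w (f v))
        = (\<Sum>w\<in>V. of_bool (E' (f u) (f w)) * walks V' E' k (f w) (f v))"
      by (rule sum.reindex_bij_betw[OF f, symmetric])
    also have "\<dots> = (\<Sum>w\<in>V. of_bool (E u w) * walks V E k w v)"
      by (intro sum.cong refl) (use Suc E in auto)
    finally show ?case by simp
  qed
  then have "closed_walks V E k = (\<Sum>u\<in>V. walks V' E' k (f u) (f u))"
    by (simp add: closed_walks_def)
  also have "\<dots> = closed_walks V' E' k"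
    unfolding closed_walks_def by (rule sum.reindex_bij_betw[OF f])
  finally show ?thesis .
qed


section \<open>Spectra of circulant graphs\<close>

text \<open>
  The arcs of \<open>Cay(\<int>\<^sub>n, S)\<close>, for residues represented by the numbers from \<open>0\<close> to \<open>n - 1\<close>.
\<close>

definition circ_adj :: "nat \<Rightarrow> int set \<Rightarrow> int \<Rightarrow> int \<Rightarrow> bool" where
  "circ_adj n S u v \<longleftrightarrow> (v - u) mod int n \<in> S"

definition zeta :: "nat \<Rightarrow> int \<Rightarrow> complex" where
  "zeta n k = cis (2 * pi * of_int k / of_nat n)"

lemma zeta_add: "zeta n (a + b) = zeta n a * zeta n b"
  by (simp add: zeta_def cis_mult add_divide_distrib ring_distribs)

lemma zeta_power: "zeta n a ^ k = zeta n (int k * a)"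
  by (simp add: zeta_def DeMoivre mult_ac)

lemma zeta_eq_1_iff:
  assumes "n > 0" shows "zeta n a = 1 \<longleftrightarrow> int n dvd a"
proof
  assume "int n dvd a"
  then obtain k where k: "a = int n * k" by blast
  have "cos (2 * pi * of_int k) = 1" "sin (2 * pi * of_int k) = 0"
    by (rule cos_int_2pin, rule sin_int_2pin)
  then show "zeta n a = 1" using assms by (simp add: zeta_def k complex_eq_iff mult.assoc)
next
  assume "zeta n a = 1"
  then have "cos (2 * pi * of_int a / of_nat n) = 1" by (simp add: zeta_def complex_eq_iff)
  then obtain k :: int where "2 * pi * of_int a / of_nat n = of_int k * 2 * pi"
    unfolding cos_one_2pi_int by blast
  then have "real_of_int a = of_int (k * int n)" using assms by (simp add: field_simps)
  then have "a = k * int n" by (simp only: of_int_eq_iff)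
  then show "int n dvd a" by simp
qed

lemma zeta_mod: "n > 0 \<Longrightarrow> zeta n (a mod int n) = zeta n a"
  using zeta_add[of n "a mod int n" "int n * (a div int n)"] zeta_eq_1_iff[of n "int n * (a div int n)"]
  by simp

lemma zeta_cong: "n > 0 \<Longrightarrow> a mod int n = b mod int n \<Longrightarrow> zeta n a = zeta n b"
  by (metis zeta_mod)

lemma sum_zeta_powers:
  assumes "int m * d mod int n = 0" "n > 0"
  shows "(\<Sum>j<m. zeta n (int j * d)) = (if int n dvd d then of_nat m else 0)"
proof (cases "int n dvd d")
  case True
  then have "zeta n (int j * d) = 1" for j using zeta_eq_1_iff[OF assms(2)] by simp
  then show ?thesis using True by simp
next
  case False
  then have ne: "zeta n d \<noteq> 1" using zeta_eq_1_iff[OF assms(2)] by simp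
  have "zeta n d ^ m = 1" using zeta_eq_1_iff[OF assms(2)] assms by (auto simp: zeta_power)
  then have "(\<Sum>j<m. zeta n d ^ j) = 0" using ne by (simp add: geometric_sum)
  then show ?thesis using False by (simp add: zeta_power)
qed

definition circ_eigenvalue :: "nat \<Rightarrow> int set \<Rightarrow> nat \<Rightarrow> complex" where
  "circ_eigenvalue n S j = (\<Sum>s\<in>S. zeta n (int j * s))"

text \<open>
  The characters \<open>u \<mapsto> \<zeta> ^ (j * u)\<close> of the cyclic group diagonalise the adjacency matrix; the formula
  is the resulting spectral decomposition of its powers.
\<close>

lemma walks_circ_adj:
  assumes S: "S \<subseteq> {0..<int n}" and u: "u \<in> {0..<int n}" and v: "v \<in> {0..<int n}"
  shows "of_nat n * of_nat (walks {0..<int n} (circ_adj n S) k u v)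
       = (\<Sum>j<n. circ_eigenvalue n S j ^ k * zeta n (int j * (u - v)))"
  using u
proof (induction k arbitrary: u)
  case 0
  have "int n dvd u - v \<longleftrightarrow> u = v"
    using 0 v by (auto dest: zdvd_imp_le) (smt (verit) atLeastLessThan_iff mod_pos_pos_trivial mod_eq_dvd_iff)
  moreover have "n > 0" using u by (cases n) auto
  ultimately show ?case using sum_zeta_powers[of n "u - v" n] by simp
next
  case (Suc k)
  have n0: "n > 0" using u by (cases n) auto
  let ?Z = "{0..<int n}"
  have fin: "finite S" using S by (rule finite_subset) simp
  have "(\<Sum>w\<in>?Z. of_bool (circ_adj n S u w) * walks ?Z (circ_adj n S) k w v)
      = (\<Sum>w\<in>{w \<in> ?Z. circ_adj n S u w}. walks ?Z (circ_adj n S) k w v)"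
    by (rule sum.mono_neutral_cong_right) auto
  also have "\<dots> = (\<Sum>s\<in>S. walks ?Z (circ_adj n S) k ((u + s) mod int n) v)"
    by (rule sum.reindex_bij_witness[of _ "\<lambda>s. (u + s) mod int n" "\<lambda>w. (w - u) mod int n"])
       (use S Suc.prems n0 in \<open>auto simp: circ_adj_def mod_simps\<close>)
  finally have "of_nat n * of_nat (walks ?Z (circ_adj n S) (Suc k) u v)
      = (\<Sum>s\<in>S. of_nat n * (of_nat (walks ?Z (circ_adj n S) k ((u + s) mod int n) v) :: complex))"
    by (simp add: sum_distrib_left)
  also have "\<dots> = (\<Sum>s\<in>S. \<Sum>j<n. circ_eigenvalue n S j ^ k * zeta n (int j * ((u + s) mod int n - v)))"
    by (intro sum.cong refl Suc.IH) (use n0 in simp)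
  also have "\<dots> = (\<Sum>s\<in>S. \<Sum>j<n. circ_eigenvalue n S j ^ k * (zeta n (int j * (u - v)) * zeta n (int j * s)))"
  proof (intro sum.cong refl)
    fix s j
    have "zeta n (int j * ((u + s) mod int n - v)) = zeta n ((u + s) mod int n - v) ^ j"
      by (simp add: zeta_power)
    also have "zeta n ((u + s) mod int n - v) = zeta n ((u - v) + s)"
      by (rule zeta_cong[OF n0]) (simp add: mod_simps algebra_simps)
    also have "\<dots> ^ j = zeta n (int j * (u - v) + int j * s)"
      by (simp add: zeta_power algebra_simps)
    finally have "zeta n (int j * ((u + s) mod int n - v)) = zeta n (int j * (u - v) + int j * s)" .
    then show "circ_eigenvalue n S j ^ k * zeta n (int j * ((u + s) mod int n - v))
      = circ_eigenvalue n S j ^ k * (zeta n (int j * (u - v)) * zeta n (int j * s))"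
      by (simp add: zeta_add)
  qed
  also have "\<dots> = (\<Sum>j<n. circ_eigenvalue n S j ^ k * zeta n (int j * (u - v)) * circ_eigenvalue n S j)"
    by (subst sum.swap) (simp add: circ_eigenvalue_def sum_distrib_left mult.assoc)
  finally show ?case by (simp add: mult_ac)
qed

lemma closed_walks_circ_adj:
  assumes S: "S \<subseteq> {0..<int n}" and n: "n > 0"
  shows "of_nat (closed_walks {0..<int n} (circ_adj n S) k) = (\<Sum>j<n. circ_eigenvalue n S j ^ k)"
proof -
  have "of_nat n * of_nat (closed_walks {0..<int n} (circ_adj n S) k)
    = (\<Sum>u\<in>{0..<int n}. of_nat n * (of_nat (walks {0..<int n} (circ_adj n S) k u u) :: complex))"
    by (simp add: closed_walks_def sum_distrib_left)
  also have "\<dots> = (\<Sum>u\<in>{0..<int n}. \<Sum>j<n. circ_eigenvalue n S j ^ k)"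
    by (intro sum.cong refl) (simp add: walks_circ_adj[OF S] zeta_def)
  also have "\<dots> = of_nat n * (\<Sum>j<n. circ_eigenvalue n S j ^ k)" by simp
  finally show ?thesis using n by simp
qed

text \<open>
  Otherwise there is a polynomial of degree at most \<open>2 * card I\<close> that vanishes at all the values of
  \<open>x\<close> and \<open>y\<close> other than \<open>x i0\<close>. Summed over the values of \<open>y\<close> it gives \<open>0\<close>, and summed over those of \<open>x\<close>
  it does not; but these sums are the same linear combination of power sums.
\<close>

lemma equal_power_sums_common_value:
  fixes x y :: "'i \<Rightarrow> complex"
  assumes fin: "finite I" and i0: "i0 \<in> I"
    and eq: "\<And>k. k \<le> 2 * card I \<Longrightarrow> (\<Sum>i\<in>I. x i ^ k) = (\<Sum>i\<in>I. y i ^ k)"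
  shows "x i0 \<in> y ` I"
proof (rule ccontr)
  assume notin: "x i0 \<notin> y ` I"
  define B where "B = (x ` I \<union> y ` I) - {x i0}"
  have finB: "finite B" using fin by (simp add: B_def)
  define P where "P = (\<Prod>c\<in>B. [:- c, 1:])"
  have "card B \<le> card (x ` I) + card (y ` I)"
    unfolding B_def by (meson Diff_subset card_Un_le card_mono fin finite_UnI finite_imageI le_trans)
  also have "\<dots> \<le> 2 * card I" using card_image_le[OF fin, of x] card_image_le[OF fin, of y] by simp
  finally have deg: "degree P \<le> 2 * card I"
    unfolding P_def by (subst degree_prod_sum_eq) auto
  have root: "poly P c = 0 \<longleftrightarrow> c \<in> B" for c
    using finB by (simp add: P_def poly_prod prod_zero_iff)
  have "(\<Sum>i\<in>I. poly P (z i)) = (\<Sum>k\<le>degree P. coeff P k * (\<Sum>i\<in>I. z i ^ k))" for z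
    by (simp add: poly_altdef sum_distrib_left sum.swap[of _ I])
  then have "(\<Sum>i\<in>I. poly P (x i)) = (\<Sum>i\<in>I. poly P (y i))" using eq deg by simp
  also have "\<dots> = 0" 
  proof (rule sum.neutral, rule ballI)
    fix i assume "i \<in> I"
    then have "y i \<in> B" using notin unfolding B_def by (metis Diff_iff UnI2 image_eqI singletonD)
    then show "poly P (y i) = 0" using root by blast
  qed
  finally have "(\<Sum>i\<in>I. poly P (x i)) = 0" .
  moreover have "(\<Sum>i\<in>I. poly P (x i)) = (\<Sum>i\<in>{i \<in> I. x i = x i0}. poly P (x i))"
    by (rule sum.mono_neutral_right) (use fin root B_def in auto)
  moreover have "\<dots> = of_nat (card {i \<in> I. x i = x i0}) * poly P (x i0)" by simp
  moreover have "poly P (x i0) \<noteq> 0" using root B_def by simp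
  moreover have "card {i \<in> I. x i = x i0} \<noteq> 0" using i0 fin by auto
  ultimately show False by simp
qed

text \<open>
  The coefficient \<open>a i\<close> of \<open>\<zeta> ^ i\<close> in the difference of the two eigenvalues is constant on each residue
  class modulo \<open>q\<close>. On a class where it is positive, \<open>S\<close> contains the whole class; on a class where it
  is negative, each of the \<open>p\<close> members is congruent to \<open>j * t\<close>
  for some \<open>t \<in> T\<close>. Both are impossible, since \<open>S\<close> and \<open>T\<close>
  have fewer than \<open>p\<close> elements.
\<close>

lemma equal_eigenvalue_imp_multiple:
  fixes S T :: "int set"
  assumes p: "Factorial_Ring.prime (p::nat)" and n: "n = p * q" "q = p ^ k"
    and S: "S \<subseteq> {0..<int n}" "card S < p" and T: "T \<subseteq> {0..<int n}" "card T < p"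
    and eq: "circ_eigenvalue n S 1 = circ_eigenvalue n T j"
  shows "S = (\<lambda>t. int j * t mod int n) ` T"
proof -
  have p1: "p > 1" using p by (rule prime_gt_1_nat)
  have q0: "q > 0" using p1 n by simp
  have n0: "n > 0" using p1 q0 n by simp
  have fin: "finite S" "finite T" using S T finite_subset by auto
  define g where "g = (\<lambda>t. nat (int j * t mod int n))"
  define c where "c = (\<lambda>i. card {t \<in> T. g t = i})"
  define a where "a = (\<lambda>i. of_bool (int i \<in> S) - int (c i))"
  let ?w = "zeta n 1"
  have w: "?w ^ i = zeta n (int i)" for i by (simp add: zeta_power)
  have "circ_eigenvalue n S 1 = (\<Sum>i\<in>{i. i < n \<and> int i \<in> S}. ?w ^ i)"
    unfolding circ_eigenvalue_def w
    by (rule sum.reindex_bij_witness[of _ int nat]) (use S in auto)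
  also have "\<dots> = (\<Sum>i<n. of_bool (int i \<in> S) * ?w ^ i)"
    by (simp add: sum.inter_filter[symmetric] of_bool_def if_distrib[of "\<lambda>x. x * _"] lessThan_def cong: if_cong)
  finally have eS: "circ_eigenvalue n S 1 = (\<Sum>i<n. of_bool (int i \<in> S) * ?w ^ i)" .
  have gT: "g ` T \<subseteq> {..<n}"
    using n0 by (auto simp: g_def nat_less_iff)
  have "circ_eigenvalue n T j = (\<Sum>t\<in>T. ?w ^ g t)"
    unfolding circ_eigenvalue_def w g_def using n0 by (simp add: zeta_mod)
  also have "\<dots> = (\<Sum>i<n. \<Sum>t\<in>{t \<in> T. g t = i}. ?w ^ g t)"
    by (rule sum.group[symmetric]) (use fin gT in auto)
  also have "\<dots> = (\<Sum>i<n. of_nat (c i) * ?w ^ i)" by (simp add: c_def)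
  finally have eT: "circ_eigenvalue n T j = (\<Sum>i<n. of_nat (c i) * ?w ^ i)" .
  have "(\<Sum>i<n. of_int (a i) * ?w ^ i) = 0"
    using eq eS eT by (simp add: a_def left_diff_distrib sum_subtractf)
  then have rel: "(\<Sum>i<p * q. of_int (a i) * ?w ^ i) = 0" using n(1) by simp
  have "(\<Sum>i<p. ?w ^ (i * q)) = (\<Sum>i<p. zeta n (int i * int q))" by (simp add: w)
  also have "\<dots> = 0"
    using sum_zeta_powers[of p "int q" n] n0 p1 q0 n by (auto dest!: zdvd_imp_le)
  finally have w0: "(\<Sum>i<p. ?w ^ (i * q)) = 0" .
  have const: "a i = a (i mod q + (p - 1) * q)" if "i < n" for i
    using prime_power_root_relation[OF p n(2) w0 rel] that n by simp
  have a0: "a i = 0" if i: "i < n" for i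
  proof -
    \<comment> \<open>The residue class of \<open>i\<close> modulo \<open>q\<close> within \<open>{..<n}\<close>.\<close>
    let ?I = "(\<lambda>m. i mod q + m * q) ` {..<p}"
    have cardI: "card ?I = p"
      using q0 by (subst card_image) (auto simp: inj_on_def)
    have less: "i mod q + m * q < n" if "m < p" for m
    proof -
      have "i mod q + m * q < Suc m * q" using q0 by simp
      also have "\<dots> \<le> p * q" using that by (intro mult_right_mono) auto
      finally show ?thesis using n by simp
    qed
    have aI: "a x = a i" if x: "x \<in> ?I" for x
    proof -
      obtain m where m: "x = i mod q + m * q" "m < p" using x by auto
      then show ?thesis using const[OF i] const[OF less[OF m(2)]] by simp
    qed
    have "\<not> a i > 0"
    proof
      assume pos: "a i > 0"
      have "int x \<in> S" if x: "x \<in> ?I" for x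
        using pos aI[OF x] by (cases "int x \<in> S") (simp_all add: a_def)
      then have "int ` ?I \<subseteq> S" by blast
      then have "card (int ` ?I) \<le> card S" by (intro card_mono fin)
      then show False using S cardI by (simp add: card_image)
    qed
    moreover have "\<not> a i < 0"
    proof
      assume neg: "a i < 0"
      have "x \<in> g ` T" if x: "x \<in> ?I" for x
      proof -
        have "a x < 0" using neg aI[OF x] by simp
        then have "c x > 0" by (cases "int x \<in> S") (simp_all add: a_def)
        then show ?thesis unfolding c_def card_gt_0_iff by blast
      qed
      then have "?I \<subseteq> g ` T" by blast
      then have "card ?I \<le> card (g ` T)" by (intro card_mono finite_imageI fin)
      also have "\<dots> \<le> card T" by (intro card_image_le fin)
      finally show False using T cardI by simp
    qed
    ultimately show ?thesis by simp
  qed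
  have mem: "int i \<in> S \<longleftrightarrow> i \<in> g ` T" if "i < n" for i
  proof -
    have "int i \<in> S \<longleftrightarrow> c i > 0" using a0[OF that] by (cases "int i \<in> S") (auto simp: a_def)
    also have "\<dots> \<longleftrightarrow> i \<in> g ` T" using fin by (auto simp: c_def card_gt_0_iff)
    finally show ?thesis .
  qed
  show ?thesis
  proof (intro equalityI subsetI)
    fix s assume s: "s \<in> S"
    then have "s \<in> {0..<int n}" using S by blast
    then have "nat s < n" "int (nat s) = s" by auto
    then have "nat s \<in> g ` T" using mem[of "nat s"] s by simp
    then obtain t where t: "t \<in> T" "nat s = g t" by blast
    then have "s = int j * t mod int n" using \<open>int (nat s) = s\<close> n0 by (simp add: g_def) 
    then show "s \<in> (\<lambda>t. int j * t mod int n) ` T" using t by blast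
  next
    fix s assume "s \<in> (\<lambda>t. int j * t mod int n) ` T"
    then obtain t where t: "t \<in> T" "s = int j * t mod int n" by blast
    then have "s = int (g t)" using n0 by (simp add: g_def)
    moreover have "g t < n" using gT t by auto
    ultimately show "s \<in> S" using mem[of "g t"] t by simp
  qed
qed

text \<open>
  The connection sets satisfy \<open>S = j T\<close>. As \<open>S\<close> has an element prime to \<open>p\<close>, so is \<open>j\<close>, and
  multiplication by \<open>j\<close> is a permutation of the vertices that maps one graph to the other.
\<close>

lemma circ_iso_if_equal_closed_walks:
  fixes S T :: "int set"
  assumes p: "Factorial_Ring.prime (p::nat)" and n: "n = p ^ l" "l > 0"
    and S: "S \<subseteq> {0..<int n}" "card S < p" and T: "T \<subseteq> {0..<int n}" "card T < p"
    and unit: "s \<in> S" "\<not> int p dvd s"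
    and eq: "\<And>k. k \<le> 2 * n \<Longrightarrow> closed_walks {0..<int n} (circ_adj n S) k
                               = closed_walks {0..<int n} (circ_adj n T) k"
  obtains f where "bij_betw f {0..<int n} {0..<int n}"
    and "\<And>u v. u \<in> {0..<int n} \<Longrightarrow> v \<in> {0..<int n} \<Longrightarrow> circ_adj n T u v \<longleftrightarrow> circ_adj n S (f u) (f v)"
proof -
  define q where "q = p ^ (l - 1)"
  have nq: "n = p * q" using n by (cases l) (auto simp: q_def)
  have p1: "p > 1" using p by (rule prime_gt_1_nat)
  have n1: "n > 1" using n p1 one_less_power by blast
  have pn: "int p dvd int n" using nq by simp
  have "(\<Sum>j<n. circ_eigenvalue n S j ^ k) = (\<Sum>j<n. circ_eigenvalue n T j ^ k)" if "k \<le> 2 * n" for k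
    using closed_walks_circ_adj[OF S(1), of k] closed_walks_circ_adj[OF T(1), of k] eq[OF that] n1
    by simp
  then have "circ_eigenvalue n S 1 \<in> circ_eigenvalue n T ` {..<n}"
    using n1 by (intro equal_power_sums_common_value) auto
  then obtain j where j: "circ_eigenvalue n S 1 = circ_eigenvalue n T j" by blast
  have ST: "S = (\<lambda>t. int j * t mod int n) ` T"
    by (rule equal_eigenvalue_imp_multiple[OF p nq q_def S T j])
  obtain t where "s = int j * t mod int n" using unit ST by blast
  then have "\<not> int p dvd int j"
    using unit(2) pn by (auto simp: dvd_mod_iff)
  then have "coprime (int p) (int j)" using p by (intro prime_imp_coprime) auto
  then have cop: "coprime (int j) (int n)" using n by (simp add: coprime_commute)
  define f where "f = (\<lambda>u. int j * u mod int n)"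
  have cancel: "int j * x mod int n = int j * y mod int n \<longleftrightarrow> x mod int n = y mod int n" for x y
    using cong_mult_lcancel[OF cop, of x y] by (simp add: cong_def)
  have inj: "inj_on f {0..<int n}"
    by (rule inj_onI) (auto simp: f_def cancel)
  moreover have "f ` {0..<int n} \<subseteq> {0..<int n}" using n1 by (auto simp: f_def)
  ultimately have bij: "bij_betw f {0..<int n} {0..<int n}"
    by (simp add: bij_betw_def endo_inj_surj)
  have "circ_adj n T u v \<longleftrightarrow> circ_adj n S (f u) (f v)" for u v
  proof -
    have "(f v - f u) mod int n = int j * ((v - u) mod int n) mod int n"
      by (simp add: f_def mod_simps algebra_simps)
    moreover have "int j * x mod int n \<in> S \<longleftrightarrow> x \<in> T" if "x \<in> {0..<int n}" for x
    proof -
      have "int j * x mod int n = int j * t mod int n \<longleftrightarrow> x = t" if "t \<in> T" for t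
        using that \<open>x \<in> {0..<int n}\<close> T unfolding cancel by auto
      then show ?thesis unfolding ST by auto
    qed
    ultimately show ?thesis using n1 by (simp add: circ_adj_def)
  qed
  then show ?thesis using bij that by blast
qed


section \<open>Isomorphism of connected circulant graphs of small degree\<close>

abbreviation arc :: "'a pair_pre_digraph \<Rightarrow> 'a \<Rightarrow> 'a \<Rightarrow> bool" where
  "arc G u v \<equiv> (u, v) \<in> parcs G"

lemma digraph_iso_with_projE:
  assumes "digraph_iso (with_proj G) (with_proj H)"
  obtains f where "bij_betw f (pverts G) (pverts H)"
    and "\<And>u v. u \<in> pverts G \<Longrightarrow> v \<in> pverts G \<Longrightarrow> arc G u v \<longleftrightarrow> arc H (f u) (f v)"
proof -
  obtain h where h: "pre_digraph.digraph_isomorphism (with_proj G) h"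
    and H: "with_proj H = app_iso h (with_proj G)"
    using assms unfolding digraph_iso_def by blast
  let ?f = "iso_verts h"
  have verts: "pverts H = ?f ` pverts G" and arcs: "parcs H = iso_arcs h ` parcs G"
    and ht: "iso_tail h = fst" "iso_head h = snd"
    using arg_cong[OF H, of verts] arg_cong[OF H, of arcs] arg_cong[OF H, of tail]
      arg_cong[OF H, of head] by simp_all
  have wf: "wf_digraph (with_proj G)" and inj: "inj_on ?f (pverts G)"
    and arc: "\<And>a. a \<in> parcs G \<Longrightarrow> ?f (fst a) = fst (iso_arcs h a) \<and> ?f (snd a) = snd (iso_arcs h a)"
    using h unfolding pre_digraph.digraph_isomorphism_def by (auto simp: ht)
  have in_verts: "fst a \<in> pverts G \<and> snd a \<in> pverts G" if "a \<in> parcs G" for a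
    using wf_digraph.tail_in_verts[OF wf, of a] wf_digraph.head_in_verts[OF wf, of a] that by simp
  have iff: "arc G u v \<longleftrightarrow> arc H (?f u) (?f v)" if uv: "u \<in> pverts G" "v \<in> pverts G" for u v
  proof
    assume "arc G u v"
    then have "iso_arcs h (u, v) \<in> parcs H" unfolding arcs by blast
    moreover have "iso_arcs h (u, v) = (?f u, ?f v)"
      using arc[OF \<open>arc G u v\<close>] by (simp add: prod_eq_iff)
    ultimately show "arc H (?f u) (?f v)" by simp
  next
    assume "arc H (?f u) (?f v)"
    then obtain a where a: "a \<in> parcs G" "iso_arcs h a = (?f u, ?f v)" unfolding arcs by force
    then have "?f (fst a) = ?f u" "?f (snd a) = ?f v" using arc[of a] by auto
    then have "fst a = u" "snd a = v" using inj in_verts[OF a(1)] uv by (auto dest: inj_onD)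
    then show "arc G u v" using a(1) by auto
  qed
  show ?thesis by (rule that[of ?f]) (use inj verts iff in \<open>auto simp: bij_betw_def\<close>)
qed

lemma digraph_iso_with_projI:
  assumes G: "pair_wf_digraph G" and H: "pair_wf_digraph H"
    and f: "bij_betw f (pverts G) (pverts H)"
    and arc: "\<And>u v. u \<in> pverts G \<Longrightarrow> v \<in> pverts G \<Longrightarrow> arc G u v \<longleftrightarrow> arc H (f u) (f v)"
  shows "digraph_iso (with_proj G) (with_proj H)"
proof -
  interpret G: pair_wf_digraph G by fact
  interpret H: pair_wf_digraph H by fact
  define h where "h = \<lparr> iso_verts = f, iso_arcs = map_prod f f, iso_head = snd, iso_tail = fst \<rparr>"
  have inj: "inj_on f (pverts G)" using f by (simp add: bij_betw_def)
  have "inj_on (map_prod f f) (parcs G)"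
    by (rule inj_on_subset[OF map_prod_inj_on[OF inj inj]]) (use G.in_arcsD1 G.in_arcsD2 in auto)
  then have "pre_digraph.digraph_isomorphism (with_proj G) h"
    using G.wf_digraph_axioms inj
    unfolding pre_digraph.digraph_isomorphism_def by (auto simp: h_def)
  moreover have "parcs H = map_prod f f ` parcs G"
  proof (intro equalityI subsetI)
    fix a assume a: "a \<in> parcs H"
    obtain x y where xy: "a = (x, y)" by fastforce
    then have "x \<in> f ` pverts G" "y \<in> f ` pverts G"
      using a H.in_arcsD1 H.in_arcsD2 f by (auto simp: bij_betw_def)
    then obtain u v where "u \<in> pverts G" "x = f u" "v \<in> pverts G" "y = f v" by blast
    then have "a = map_prod f f (u, v)" "arc G u v" using a arc[of u v] xy by auto
    then show "a \<in> map_prod f f ` parcs G" by blast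
  next
    fix a assume "a \<in> map_prod f f ` parcs G"
    then obtain u v where "a = (f u, f v)" "arc G u v" by auto
    then show "a \<in> parcs H" using arc[of u v] G.in_arcsD1 G.in_arcsD2 by blast
  qed
  then have "with_proj H = app_iso h (with_proj G)"
    using f by (simp add: app_iso_def h_def with_proj_def bij_betw_def)
  ultimately show ?thesis unfolding digraph_iso_def by blast
qed

text \<open>
  Connectedness enters through the element \<open>s\<close>: if \<open>p\<close> divided every element of \<open>S\<close>, the residue
  modulo \<open>p\<close> would be constant along arcs, and \<open>0\<close> and \<open>1\<close> would lie in different components.
\<close>

lemma conn_circulant_prime_powerE:
  assumes G: "G \<in> conn_circulant_prime_power" and fin: "finite (parcs G)"
  obtains p l S f s where "Factorial_Ring.prime p" "l > 0" "S \<subseteq> {0..<int (p ^ l)}" "card S < p"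
    "s \<in> S" "\<not> int p dvd s" "bij_betw f (pverts G) {0..<int (p ^ l)}"
    "\<And>u v. u \<in> pverts G \<Longrightarrow> v \<in> pverts G \<Longrightarrow> arc G u v \<longleftrightarrow> circ_adj (p ^ l) S (f u) (f v)"
proof -
  obtain p l where p: "Factorial_Ring.prime p" and l: "l > 3" and circ: "circulant (p ^ l) G"
    and conn: "Digraph_Component.connected (with_proj G)"
    and deg: "\<And>v. v \<in> pverts G \<Longrightarrow> out_degree (with_proj G) v < p"
    using G unfolding conn_circulant_prime_power_def by blast
  define n where "n = p ^ l"
  have p1: "p > 1" using p by (rule prime_gt_1_nat)
  then have n1: "n > 1" using l one_less_power[of p l] by (simp add: n_def)
  obtain S where "S \<subseteq> carrier (integer_mod_group n) - {\<one>\<^bsub>integer_mod_group n\<^esub>}"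
    and iso: "digraph_iso (with_proj G) (with_proj (cayley_digraph (integer_mod_group n) S))"
    using circ unfolding circulant_def n_def by blast
  then have S: "S \<subseteq> {0..<int n}" using n1 by (auto simp: carrier_integer_mod_group split: if_splits)
  let ?C = "cayley_digraph (integer_mod_group n) S"
  have verts: "pverts ?C = {0..<int n}"
    using n1 by (simp add: cayley_digraph_def carrier_integer_mod_group)
  have arcC: "arc ?C x y \<longleftrightarrow> circ_adj n S x y" if xy: "x \<in> {0..<int n}" "y \<in> {0..<int n}" for x y
  proof
    assume "arc ?C x y"
    then obtain s where s: "s \<in> S" "y = (s + x) mod int n"
      by (auto simp: cayley_digraph_def)
    have "(y - x) mod int n = s mod int n" unfolding s(2) by (simp add: mod_simps)
    then show "circ_adj n S x y" using s(1) S by (auto simp: circ_adj_def subset_eq)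
  next
    assume "circ_adj n S x y"
    moreover have "y = ((y - x) mod int n + x) mod int n" using xy by (simp add: mod_simps)
    ultimately show "arc ?C x y"
      using xy n1 by (auto simp: cayley_digraph_def circ_adj_def carrier_integer_mod_group)
  qed
  obtain f where f: "bij_betw f (pverts G) {0..<int n}"
    and adj: "\<And>u v. u \<in> pverts G \<Longrightarrow> v \<in> pverts G \<Longrightarrow> arc G u v \<longleftrightarrow> arc ?C (f u) (f v)"
    using digraph_iso_with_projE[OF iso] unfolding verts by blast
  have fin_range: "f u \<in> {0..<int n}" if "u \<in> pverts G" for u
    using f that by (auto simp: bij_betw_def)
  have adj': "arc G u v \<longleftrightarrow> circ_adj n S (f u) (f v)" if "u \<in> pverts G" "v \<in> pverts G" for u v
    using adj[OF that] arcC fin_range that by simp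
  have surj: "\<exists>u \<in> pverts G. f u = x" if "x \<in> {0..<int n}" for x
    using that unfolding bij_betw_imp_surj_on[OF f, symmetric] by blast
  have cardS: "card S < p"
  proof -
    obtain u where u: "u \<in> pverts G" "f u = 0" using surj[of 0] n1 by auto
    have "S \<subseteq> (f \<circ> snd) ` out_arcs (with_proj G) u"
    proof
      fix s assume s: "s \<in> S"
      then have "s \<in> {0..<int n}" using S by blast
      then obtain v where v: "v \<in> pverts G" "f v = s" using surj by blast
      have "arc G u v" using adj'[OF u(1) v(1)] u(2) v(2) s \<open>s \<in> {0..<int n}\<close> 
        by (simp add: circ_adj_def)
      then show "s \<in> (f \<circ> snd) ` out_arcs (with_proj G) u" using v by force
    qed
    moreover have fo: "finite (out_arcs (with_proj G) u)"
      by (rule finite_subset[OF _ fin]) auto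
    ultimately have "card S \<le> card (out_arcs (with_proj G) u)" by (rule surj_card_le[rotated])
    then show ?thesis using deg[OF u(1)] by (simp add: out_degree_def)
  qed
  have "\<exists>s\<in>S. \<not> int p dvd s"
  proof (rule ccontr)
    assume "\<not> (\<exists>s\<in>S. \<not> int p dvd s)"
    then have dvd: "int p dvd s" if "s \<in> S" for s using that by blast
    have pn: "int p dvd int n" using l by (simp add: n_def)
    have arc_mod: "f u mod int p = f v mod int p" if "arc G u v" "u \<in> pverts G" "v \<in> pverts G" for u v
    proof -
      have "int p dvd (f v - f u) mod int n"
        using dvd adj' that by (simp add: circ_adj_def)
      then show ?thesis using pn by (simp add: dvd_mod_iff mod_eq_dvd_iff dvd_diff_commute)
    qed
    obtain u v where uv: "u \<in> pverts G" "f u = 0" "v \<in> pverts G" "f v = 1"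
      using surj[of 0] surj[of 1] n1 by auto
    let ?M = "with_proj (mk_symmetric (with_proj G))"
    have wf: "wf_digraph (with_proj G)"
      using iso unfolding digraph_iso_def pre_digraph.digraph_isomorphism_def by blast
    have reach: "u \<rightarrow>\<^sup>*\<^bsub>?M\<^esub> v"
      using conn uv unfolding connected_def strongly_connected_def by (simp add: mk_symmetric_def)
    then have "(u, v) \<in> (arcs_ends ?M)\<^sup>*" 
      unfolding reachable_def by (rule rtrancl_on_rtranclI)
    then have "f u mod int p = f v mod int p"
    proof (induction rule: rtrancl_induct)
      case (step y z)
      then have "arc G y z \<or> arc G z y" by (auto simp: parcs_mk_symmetric)
      moreover have "y \<in> pverts G \<and> z \<in> pverts G"
        using calculation wf_digraph.head_in_verts[OF wf, of "(y, z)"] wf_digraph.tail_in_verts[OF wf, of "(y, z)"]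
          wf_digraph.head_in_verts[OF wf, of "(z, y)"] wf_digraph.tail_in_verts[OF wf, of "(z, y)"] by auto
      ultimately have "f y mod int p = f z mod int p" using arc_mod[of y z] arc_mod[of z y] by auto
      then show ?case using step by simp
    qed simp
    then show False using uv p1 by simp
  qed
  then obtain s where "s \<in> S" "\<not> int p dvd s" by blast
  then show ?thesis using that[of p l S s f] p l S cardS f adj' unfolding n_def by simp
qed

text \<open>
  The orders being equal, both graphs are circulant for the same prime. Isomorphisms with the two
  standard circulant graphs reduce the claim to these.
\<close>

theorem conn_circulant_iso_iff_closed_walks:
  assumes G: "G \<in> conn_circulant_prime_power" "pair_digraph G"
    and H: "H \<in> conn_circulant_prime_power" "pair_digraph H"
    and n: "card (pverts G) = n" "card (pverts H) = n"
  shows "digraph_iso (with_proj G) (with_proj H) \<longleftrightarrow>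
    (\<forall>k \<le> 2 * n. closed_walks (pverts G) (arc G) k = closed_walks (pverts H) (arc H) k)"
proof
  assume "digraph_iso (with_proj G) (with_proj H)"
  then obtain f where "bij_betw f (pverts G) (pverts H)"
    and "\<And>u v. u \<in> pverts G \<Longrightarrow> v \<in> pverts G \<Longrightarrow> arc G u v \<longleftrightarrow> arc H (f u) (f v)"
    by (rule digraph_iso_with_projE) blast
  then show "\<forall>k \<le> 2 * n. closed_walks (pverts G) (arc G) k = closed_walks (pverts H) (arc H) k"
    by (intro allI impI closed_walks_iso)
next
  assume eq: "\<forall>k \<le> 2 * n. closed_walks (pverts G) (arc G) k = closed_walks (pverts H) (arc H) k"
  interpret G: pair_digraph G by fact
  interpret H: pair_digraph H by fact
  obtain p l S f s where p: "Factorial_Ring.prime p" "l > 0" and S: "S \<subseteq> {0..<int (p ^ l)}" "card S < p"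
    and s: "s \<in> S" "\<not> int p dvd s" and f: "bij_betw f (pverts G) {0..<int (p ^ l)}"
    and fa: "\<And>u v. u \<in> pverts G \<Longrightarrow> v \<in> pverts G \<Longrightarrow> arc G u v \<longleftrightarrow> circ_adj (p ^ l) S (f u) (f v)"
    by (rule conn_circulant_prime_powerE[OF G(1) G.pair_finite_arcs]) blast
  obtain p' l' T g t where p': "Factorial_Ring.prime p'" "l' > 0" and T: "T \<subseteq> {0..<int (p' ^ l')}" "card T < p'"
    and t: "t \<in> T" "\<not> int p' dvd t" and g: "bij_betw g (pverts H) {0..<int (p' ^ l')}"
    and ga: "\<And>u v. u \<in> pverts H \<Longrightarrow> v \<in> pverts H \<Longrightarrow> arc H u v \<longleftrightarrow> circ_adj (p' ^ l') T (g u) (g v)"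
    by (rule conn_circulant_prime_powerE[OF H(1) H.pair_finite_arcs]) blast
  have n': "n = p ^ l" "n = p' ^ l'"
    using bij_betw_same_card[OF f] bij_betw_same_card[OF g] n by (simp_all del: of_nat_power)
  then have "p dvd p' ^ l'" using p(2) by (metis dvd_power)
  then have "p dvd p'" using p by (metis prime_dvd_power_nat)
  then have pp: "p' = p" using p p' primes_dvd_imp_eq by blast
  let ?Z = "{0..<int n}"
  note S = S[folded n'] and T = T[folded n', unfolded pp] and f = f[folded n'] and g = g[folded n']
    and fa = fa[folded n'] and ga = ga[folded n']
  have "closed_walks ?Z (circ_adj n S) k = closed_walks ?Z (circ_adj n T) k" if "k \<le> 2 * n" for k
    using closed_walks_iso[OF f, of "arc G" "circ_adj n S" k, OF fa]
      closed_walks_iso[OF g, of "arc H" "circ_adj n T" k, OF ga] eq that by simp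
  then obtain h where h: "bij_betw h ?Z ?Z"
    and ha: "\<And>u v. u \<in> ?Z \<Longrightarrow> v \<in> ?Z \<Longrightarrow> circ_adj n T u v \<longleftrightarrow> circ_adj n S (h u) (h v)"
    using circ_iso_if_equal_closed_walks[OF p(1) n'(1) p(2) S T s] by blast
  obtain f' where f': "bij_betw f' ?Z (pverts G)" "\<And>x. x \<in> ?Z \<Longrightarrow> f (f' x) = x"
    using bij_betw_inv_into[OF f] bij_betw_inv_into_right[OF f] by blast
  have "bij_betw (\<lambda>u. f' (h (g u))) (pverts H) (pverts G)"
    using bij_betw_trans[OF bij_betw_trans[OF g h] f'(1)] by (simp add: comp_def)
  moreover have "arc H u v \<longleftrightarrow> arc G (f' (h (g u))) (f' (h (g v)))"
    if uv: "u \<in> pverts H" "v \<in> pverts H" for u v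
  proof -
    have "g u \<in> ?Z" "g v \<in> ?Z" using g uv by (auto simp: bij_betw_def)
    moreover have "h (g u) \<in> ?Z" "h (g v) \<in> ?Z" using calculation h unfolding bij_betw_def by blast+
    moreover have "f' (h (g u)) \<in> pverts G" "f' (h (g v)) \<in> pverts G"
      using calculation f' unfolding bij_betw_def by blast+
    ultimately show ?thesis using ga[OF uv] ha fa f'(2) by simp
  qed
  ultimately have "digraph_iso (with_proj H) (with_proj G)"
    using G.pair_wf_digraph_axioms H.pair_wf_digraph_axioms by (intro digraph_iso_with_projI)
  then show "digraph_iso (with_proj G) (with_proj H)"
    using H.wf_digraph_axioms by (rule digraph_iso_swap[rotated])
qed


section \<open>Common multiples of an initial segment\<close>

text \<open>
  The numbers \<open>1 / ((n + 1) * (n choose k))\<close> form Leibniz' harmonic triangle. Each entry is the difference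
  of the entry above it and its left neighbour, and the entries at the left border are \<open>1 / (n + 1)\<close>; hence
  all of them are integer combinations of \<open>1, 1/2, \<dots>, 1/(n + 1)\<close>.
\<close>

lemma leibniz_triangle_integral:
  assumes "k \<le> n" "\<And>m. m \<in> {1..n + 1} \<Longrightarrow> m dvd L"
  shows "real L / (real (n + 1) * real (n choose k)) \<in> \<int>"
  using assms
proof (induction k arbitrary: n)
  case 0
  have "n + 1 dvd L" using 0(2)[of "n + 1"] by simp
  then obtain c where "L = (n + 1) * c" by blast
  then have "real L / (real (n + 1) * real (n choose 0)) = real c"
    by (simp add: field_simps)
  then show ?case by simp
next
  case (Suc k)
  then obtain m where m: "n = Suc m" "k \<le> m" by (cases n) auto
  have "n choose k > 0" "n choose Suc k > 0" "m choose k > 0"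
    using Suc.prems m(2) by (simp_all only: m(1) zero_less_binomial_iff)
  then have pos: "real (m choose k) > 0" "real (n choose k) > 0" "real (n choose Suc k) > 0"
    by simp_all
  have "Suc k * (n choose Suc k) = n * (m choose k)"
    using Suc_times_binomial[of k m] unfolding m(1) .
  then have a: "real (Suc k) * real (n choose Suc k) = real n * real (m choose k)"
    by (simp only: of_nat_mult[symmetric])
  have "(n - k) * (n choose k) = n * (m choose k)"
    using binomial_absorb_comp[of n k] unfolding m(1) by simp
  then have b: "real (n - k) * real (n choose k) = real n * real (m choose k)"
    by (simp only: of_nat_mult[symmetric])
  have n0: "real n > 0" and nk: "real (n - k) + real (Suc k) = real (n + 1)" using m by simp_all
  have "1 / (real (n + 1) * real (n choose Suc k)) + 1 / (real (n + 1) * real (n choose k))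
      = (1 / real (n + 1)) * (1 / real (n choose Suc k) + 1 / real (n choose k))"
    by (simp add: distrib_left)
  also have "1 / real (n choose Suc k) = real (Suc k) / (real n * real (m choose k))"
    by (subst frac_eq_eq) (use pos n0 a in \<open>simp_all only: mult_1 mult_eq_0_iff, auto\<close>)
  also have "1 / real (n choose k) = real (n - k) / (real n * real (m choose k))"
    by (subst frac_eq_eq) (use pos n0 b in \<open>simp_all only: mult_1 mult_eq_0_iff, auto\<close>)
  also have "real (Suc k) / (real n * real (m choose k)) + real (n - k) / (real n * real (m choose k))
      = real (n + 1) / (real n * real (m choose k))"
    by (simp only: add_divide_distrib[symmetric] nk add.commute[of "real (Suc k)"])
  finally have "1 / (real (n + 1) * real (n choose Suc k))
      = 1 / (real (m + 1) * real (m choose k)) - 1 / (real (n + 1) * real (n choose k))"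
    using m(1) by simp
  then have "real L / (real (n + 1) * real (n choose Suc k))
      = real L / (real (m + 1) * real (m choose k)) - real L / (real (n + 1) * real (n choose k))"
    by (metis (no_types, opaque_lifting) mult.right_neutral right_diff_distrib times_divide_eq_right)
  moreover have "real L / (real (m + 1) * real (m choose k)) \<in> \<int>"
    using Suc.prems m by (intro Suc.IH) auto
  moreover have "real L / (real (n + 1) * real (n choose k)) \<in> \<int>"
    using Suc.prems by (intro Suc.IH) auto
  ultimately show ?case by (simp only: Ints_diff)
qed

text \<open>
  By integrality of \<open>L\<close> times the entries of the harmonic triangle, \<open>(n + 1) * (n choose k) \<le> L\<close> for
  each of the \<open>n + 1\<close> values of \<open>k\<close>. Summing these inequalities gives the bound.
\<close>

lemma two_power_le_common_multiple:
  assumes "L > 0" "\<And>m. m \<in> {1..n + 1} \<Longrightarrow> m dvd L"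
  shows "2 ^ n \<le> L"
proof -
  have "(n + 1) * (n choose k) \<le> L" if k: "k \<le> n" for k
  proof -
    have pos: "real (n + 1) * real (n choose k) > 0" using k by (simp add: zero_less_binomial_iff)
    let ?q = "real L / (real (n + 1) * real (n choose k))"
    have "?q \<in> \<int>" by (rule leibniz_triangle_integral[OF k assms(2)])
    moreover have "?q > 0" using pos assms(1) by simp
    ultimately have "?q \<ge> 1" by (auto elim!: Ints_cases)
    then have "real ((n + 1) * (n choose k)) \<le> real L" using pos by (simp add: field_simps)
    then show ?thesis by (simp only: of_nat_le_iff)
  qed
  then have "(\<Sum>k\<le>n. (n + 1) * (n choose k)) \<le> (\<Sum>k\<le>n. L)" by (intro sum_mono) auto
  then have "(n + 1) * 2 ^ n \<le> (n + 1) * L"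
    by (simp add: sum_distrib_left[symmetric] choose_row_sum del: mult_Suc)
  then show ?thesis by (simp only: mult_le_cancel1)
qed

lemma eq_if_small_residues_eq:
  fixes x y :: nat
  assumes "x < 2 ^ n" "y < 2 ^ n" and eq: "\<And>m. m \<in> {1..n + 1} \<Longrightarrow> x mod m = y mod m"
  shows "x = y"
proof -
  have "x = y" if xy: "x \<le> y" "y < 2 ^ n" "\<And>m. m \<in> {1..n + 1} \<Longrightarrow> x mod m = y mod m" for x y
  proof (rule ccontr)
    assume "x \<noteq> y"
    then have "2 ^ n \<le> y - x"
      using xy by (intro two_power_le_common_multiple) (auto simp: mod_eq_dvd_iff_nat[symmetric])
    then show False using xy by simp
  qed
  from this[of x y] this[of y x] show ?thesis using assms by (metis nat_le_linear)
qed


section \<open>Layered straight-line programs\<close>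

text \<open>
  \<open>slp R d s F F'\<close>: from the available functions \<open>F\<close>, the functions \<open>F'\<close> are obtained in at most \<open>d\<close>
  parallel layers of altogether at most \<open>s\<close> elementary steps, where \<open>R a b g\<close> says that \<open>g\<close> results from \<open>a\<close> and
  \<open>b\<close> by one step. Programs are thus described by the functions that they compute. The notion is used
  twice, for arithmetic on natural numbers and for Boolean operations.
\<close>

inductive slp :: "('f \<Rightarrow> 'f \<Rightarrow> 'f \<Rightarrow> bool) \<Rightarrow> nat \<Rightarrow> nat \<Rightarrow> 'f set \<Rightarrow> 'f set \<Rightarrow> bool"
  for R :: "'f \<Rightarrow> 'f \<Rightarrow> 'f \<Rightarrow> bool" where
  slp_refl: "slp R 0 0 F F"
| slp_layer: "slp R d s F F' \<Longrightarrow> finite G \<Longrightarrow> (\<And>g. g \<in> G \<Longrightarrow> \<exists>a\<in>F'. \<exists>b\<in>F'. R a b g)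
    \<Longrightarrow> slp R (Suc d) (s + card G) F (F' \<union> G)"
| slp_weaken: "slp R d s F F' \<Longrightarrow> F'' \<subseteq> F' \<Longrightarrow> d \<le> d' \<Longrightarrow> s \<le> s' \<Longrightarrow> slp R d' s' F F''"

lemma slp_trans:
  assumes "slp R d' s' F' F''" "slp R d s F F'"
  shows "slp R (d + d') (s + s') F F''"
  using assms
proof (induction rule: slp.induct)
  case (slp_layer d' s' F' F'' G)
  then show ?case using slp.slp_layer[of R "d + d'" "s + s'" F F'' G] by (simp add: add.assoc)
next
  case (slp_weaken d s F F' F'' d' s')
  then show ?case by (blast intro: slp.slp_weaken add_left_mono)
qed simp

text \<open>
  Formulas of bounded depth over the available functions. A formula of depth \<open>h\<close> has exponential size,
  so formulas serve only for the logarithmic depths between two points where results are shared.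
\<close>

inductive form :: "('f \<Rightarrow> 'f \<Rightarrow> 'f \<Rightarrow> bool) \<Rightarrow> 'f set \<Rightarrow> nat \<Rightarrow> 'f \<Rightarrow> bool"
  for R :: "'f \<Rightarrow> 'f \<Rightarrow> 'f \<Rightarrow> bool" and F :: "'f set" where
  form_base: "f \<in> F \<Longrightarrow> form R F h f"
| form_op: "form R F h a \<Longrightarrow> form R F h b \<Longrightarrow> R a b g \<Longrightarrow> form R F (Suc h) g"

lemma form_mono:
  assumes "form R F h f" "h \<le> h'" shows "form R F h' f"
  using assms
proof (induction arbitrary: h' rule: form.induct)
  case (form_op h a b g)
  then obtain h'' where "h' = Suc h''" "h \<le> h''" by (cases h') auto
  then show ?case using form_op by (auto intro: form.form_op)
qed (rule form_base)

text \<open>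
  A balanced tree of binary operations. The three uses are disjunctions, conjunctions and sums over a
  finite index set.
\<close>

lemma form_aggregate:
  assumes agg_empty: "agg {} \<in> F"
    and agg_single: "\<And>i. i \<in> I \<Longrightarrow> form R F d (agg {i})"
    and agg_union: "\<And>A B. A \<union> B \<subseteq> I \<Longrightarrow> A \<inter> B = {} \<Longrightarrow> R (agg A) (agg B) (agg (A \<union> B))"
    and fin: "finite I" and card: "card I \<le> 2 ^ h"
  shows "form R F (d + h) (agg I)"
proof -
  have "form R F (d + h) (agg J)" if "J \<subseteq> I" "card J \<le> 2 ^ h" for J
    using that
  proof (induction h arbitrary: J)
    case 0
    have "finite J" using 0 fin finite_subset by blast
    show ?case
    proof (cases "J = {}")
      case True
      then show ?thesis using agg_empty by (auto intro: form_base)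
    next
      case False
      then have "card J = 1" using 0 \<open>finite J\<close> by (simp add: card_gt_0_iff le_antisym Suc_le_eq)
      then obtain i where "J = {i}" by (auto simp: card_1_singleton_iff)
      then show ?thesis using agg_single 0 by auto
    qed
  next
    case (Suc h)
    have "finite J" using Suc fin finite_subset by blast
    have "\<exists>A\<subseteq>J. card A = min (card J) (2 ^ h)"
      by (metis min.cobounded1 obtain_subset_with_card_n)
    then obtain A where A: "A \<subseteq> J" "card A = min (card J) (2 ^ h)" by blast
    let ?B = "J - A"
    have "card ?B \<le> 2 ^ h"
      using A Suc.prems \<open>finite J\<close> by (simp add: card_Diff_subset finite_subset)
    then have B: "form R F (d + h) (agg ?B)" using Suc A by (intro Suc.IH) auto
    have "form R F (d + h) (agg A)" using Suc A by (intro Suc.IH) auto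
    moreover have "R (agg A) (agg ?B) (agg J)"
      using agg_union[of A ?B] A Suc.prems by (simp add: Un_absorb1)
    ultimately show ?case using B by (auto intro: form_op)
  qed
  then show ?thesis using card by simp
qed

text \<open>
  The formulas are unfolded from the root: replacing each one by its two immediate subformulas at most
  doubles their number. As \<open>2 * 4 ^ h + 1 \<le> 4 ^ (h + 1)\<close>, the total stays below the bound.
\<close>

lemma slp_of_forms:
  assumes "finite G" "\<And>g. g \<in> G \<Longrightarrow> form R F h g"
  shows "slp R h (card G * 4 ^ h) F (F \<union> G)"
  using assms
proof (induction h arbitrary: G)
  case 0
  have "G \<subseteq> F" using 0(2) by (auto elim: form.cases)
  then show ?case by (intro slp_weaken[OF slp_refl]) auto
next
  case (Suc h)
  define D where "D = {g \<in> G. \<exists>a b. form R F h a \<and> form R F h b \<and> R a b g}"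
  have "\<forall>g\<in>D. \<exists>a b. form R F h a \<and> form R F h b \<and> R a b g" by (simp add: D_def)
  then obtain l r where lr: "\<And>g. g \<in> D \<Longrightarrow> form R F h (l g) \<and> form R F h (r g) \<and> R (l g) (r g) g"
    by metis
  have D: "finite D" "card D \<le> card G" using Suc.prems by (auto simp: D_def intro: card_mono)
  have rest: "G - D \<subseteq> F"
  proof
    fix g assume g: "g \<in> G - D"
    then have "form R F (Suc h) g" using Suc.prems by blast
    then show "g \<in> F" using g by (cases rule: form.cases) (auto simp: D_def)
  qed
  let ?A = "l ` D \<union> r ` D"
  have "card ?A \<le> card (l ` D) + card (r ` D)" by (rule card_Un_le)
  also have "\<dots> \<le> 2 * card G" using card_image_le[OF D(1), of l] card_image_le[OF D(1), of r] D(2) by simp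
  finally have A: "card ?A \<le> 2 * card G" .
  have "slp R h (card ?A * 4 ^ h) F (F \<union> ?A)"
    using D lr by (intro Suc.IH) auto
  then have "slp R (Suc h) (card ?A * 4 ^ h + card D) F (F \<union> ?A \<union> D)"
    using D(1) by (rule slp_layer) (use lr in blast)
  moreover have "card ?A * 4 ^ h + card D \<le> card G * 4 ^ Suc h"
  proof -
    have "card ?A * 4 ^ h + card D \<le> 2 * card G * 4 ^ h + card G * 4 ^ h"
      using A D(2) by (intro add_mono mult_right_mono order.trans[OF D(2)]) auto
    then show ?thesis by simp
  qed
  ultimately show ?case by (intro slp_weaken[where s' = "card G * 4 ^ Suc h"]) (use rest in auto)
qed


section \<open>From arithmetic to Boolean programs\<close>

text \<open>
  Negation is a binary operation that ignores one argument, so that all gates fit one pattern.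
\<close>

definition bool_op :: "('x \<Rightarrow> bool) \<Rightarrow> ('x \<Rightarrow> bool) \<Rightarrow> ('x \<Rightarrow> bool) \<Rightarrow> bool" where
  "bool_op a b g \<longleftrightarrow> g = (\<lambda>x. \<not> a x) \<or> g = (\<lambda>x. a x \<and> b x) \<or> g = (\<lambda>x. a x \<or> b x)"

definition nat_op :: "('x \<Rightarrow> nat) \<Rightarrow> ('x \<Rightarrow> nat) \<Rightarrow> ('x \<Rightarrow> nat) \<Rightarrow> bool" where
  "nat_op a b g \<longleftrightarrow> g = (\<lambda>x. a x + b x) \<or> g = (\<lambda>x. a x * b x)"

definition bool_inputs :: "nat \<Rightarrow> (bool list \<Rightarrow> bool) set" where
  "bool_inputs N = (\<lambda>i x. x ! i) ` {..<N} \<union> {\<lambda>x. True, \<lambda>x. False}"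

definition nat_inputs :: "nat \<Rightarrow> (bool list \<Rightarrow> nat) set" where
  "nat_inputs N = (\<lambda>i x. of_bool (x ! i)) ` {..<N} \<union> {\<lambda>x. 0, \<lambda>x. 1}"

text \<open>
  The unary representation of the values of \<open>V\<close> modulo all positive \<open>m \<le> M\<close>: one bit for each possible
  residue.
\<close>

definition residue_bits :: "nat \<Rightarrow> ('x \<Rightarrow> nat) set \<Rightarrow> ('x \<Rightarrow> bool) set" where
  "residue_bits M V = {f. \<exists>v\<in>V. \<exists>m\<in>{1..M}. \<exists>c<M. f = (\<lambda>x. v x mod m = c)}"

lemma form_not: "form bool_op F d f \<Longrightarrow> form bool_op F (Suc d) (\<lambda>x. \<not> f x)"
  by (rule form_op[of bool_op F d f f]) (auto simp: bool_op_def)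

lemma form_conj:
  "form bool_op F d f \<Longrightarrow> form bool_op F d g \<Longrightarrow> form bool_op F (Suc d) (\<lambda>x. f x \<and> g x)"
  by (rule form_op[of bool_op F d f g]) (auto simp: bool_op_def)

lemma form_Ex:
  assumes "(\<lambda>x. False) \<in> F" "\<And>i. i \<in> I \<Longrightarrow> form bool_op F d (f i)" "finite I" "card I \<le> 2 ^ h"
  shows "form bool_op F (d + h) (\<lambda>x. \<exists>i\<in>I. f i x)"
  by (rule form_aggregate[of "\<lambda>I x. \<exists>i\<in>I. f i x"]) (use assms in \<open>auto simp: bool_op_def\<close>)

lemma form_All:
  assumes "(\<lambda>x. True) \<in> F" "\<And>i. i \<in> I \<Longrightarrow> form bool_op F d (f i)" "finite I" "card I \<le> 2 ^ h"
  shows "form bool_op F (d + h) (\<lambda>x. \<forall>i\<in>I. f i x)"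
  by (rule form_aggregate[of "\<lambda>I x. \<forall>i\<in>I. f i x"]) (use assms in \<open>auto simp: bool_op_def\<close>)

lemma form_sum:
  assumes "(\<lambda>x. 0) \<in> F" "\<And>i. i \<in> I \<Longrightarrow> form nat_op F d (f i)" "finite I" "card I \<le> 2 ^ h"
  shows "form nat_op F (d + h) (\<lambda>x. \<Sum>i\<in>I. f i x)"
  by (rule form_aggregate[of "\<lambda>I x. \<Sum>i\<in>I. f i x"])
     (use assms in \<open>auto simp: nat_op_def finite_subset sum.union_disjoint\<close>)

lemma card_residue_bits:
  assumes "finite V"
  shows "finite (residue_bits M V)" "card (residue_bits M V) \<le> card V * M * M"
proof -
  have eq: "residue_bits M V = (\<lambda>(v, m, c) x. v x mod m = c) ` (V \<times> {1..M} \<times> {..<M})"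
    by (force simp: residue_bits_def)
  show "finite (residue_bits M V)" using assms by (simp add: eq)
  have "card (residue_bits M V) \<le> card (V \<times> {1..M} \<times> {..<M})"
    unfolding eq using assms by (intro card_image_le) auto
  then show "card (residue_bits M V) \<le> card V * M * M" by (simp add: card_cartesian_product mult.assoc)
qed

text \<open>
  The residue of a sum or product depends only on the residues of the arguments: it is \<open>c\<close> if and only
  if the arguments have one of the pairs of residues that are combined to \<open>c\<close>. This is a disjunction of
  at most \<open>m * m\<close> conjunctions of two bits.
\<close>

lemma form_residue_of_nat_op:
  assumes M: "M \<le> 2 ^ h" and ab: "a \<in> V" "b \<in> V" and g: "nat_op a b g"
    and f: "f \<in> residue_bits M {g}" and F: "residue_bits M V \<subseteq> F" "(\<lambda>x. False) \<in> F"
  shows "form bool_op F (2 * h + 1) f"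
proof -
  obtain m c where mc: "m \<in> {1..M}" "c < M" and f: "f = (\<lambda>x. g x mod m = c)"
    using f by (auto simp: residue_bits_def)
  obtain opn where opn: "g = (\<lambda>x. opn (a x) (b x))" "\<And>i j. opn i j mod m = opn (i mod m) (j mod m) mod m"
  proof (cases "g = (\<lambda>x. a x + b x)")
    case True
    then show ?thesis by (intro that[of "(+)"]) (simp_all add: mod_simps)
  next
    case False
    then show ?thesis using g by (intro that[of "(*)"]) (simp_all add: mod_simps nat_op_def)
  qed
  define I where "I = {ij \<in> {..<m} \<times> {..<m}. opn (fst ij) (snd ij) mod m = c}"
  have "card I \<le> card ({..<m} \<times> {..<m})" unfolding I_def by (intro card_mono) auto
  also have "\<dots> = m * m" by (simp add: card_cartesian_product)
  also have "\<dots> \<le> 2 ^ h * 2 ^ h" using M mc by (intro mult_mono) auto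
  finally have cardI: "card I \<le> 2 ^ (2 * h)" by (simp add: mult_2 power_add)
  have bit: "form bool_op F 0 (\<lambda>x. v x mod m = i)" if "v \<in> V" "i < m" for v i
  proof (rule form_base)
    have "(\<lambda>x. v x mod m = i) \<in> residue_bits M V"
      unfolding residue_bits_def using that mc by (intro CollectI bexI[of _ v] bexI[of _ m] exI[of _ i]) auto
    then show "(\<lambda>x. v x mod m = i) \<in> F" using F by auto
  qed
  have "form bool_op F (1 + 2 * h) (\<lambda>x. \<exists>ij\<in>I. a x mod m = fst ij \<and> b x mod m = snd ij)"
  proof (rule form_Ex)
    fix ij assume "ij \<in> I"
    then have "fst ij < m" "snd ij < m" by (auto simp: I_def)
    then have "form bool_op F (Suc 0) (\<lambda>x. a x mod m = fst ij \<and> b x mod m = snd ij)"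
      by (intro form_conj bit ab)
    then show "form bool_op F 1 (\<lambda>x. a x mod m = fst ij \<and> b x mod m = snd ij)" by simp
  qed (use F cardI in \<open>auto simp: I_def\<close>)
  moreover have "(\<lambda>x. \<exists>ij\<in>I. a x mod m = fst ij \<and> b x mod m = snd ij) = f"
  proof
    fix x
    show "(\<exists>ij\<in>I. a x mod m = fst ij \<and> b x mod m = snd ij) = f x"
      using mc opn(2)[of "a x" "b x"] by (auto simp: I_def f opn(1))
  qed
  ultimately show ?thesis by (simp add: add.commute)
qed

lemma slp_bool_of_slp_nat:
  assumes "slp nat_op d s V V'" and M: "M \<le> 2 ^ h" and F: "(\<lambda>x. False) \<in> F"
  shows "slp bool_op (d * (2 * h + 1)) (s * (M * M * 4 ^ (2 * h + 1)))
           (residue_bits M V \<union> F) (residue_bits M V' \<union> F)"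
  using assms(1)
proof (induction rule: slp.induct)
  case (slp_refl V)
  show ?case by (rule slp_weaken[OF slp.slp_refl]) auto
next
  case (slp_layer d s V V' G)
  let ?B = "residue_bits M V' \<union> F" and ?k = "M * M * 4 ^ (2 * h + 1)"
  have "form bool_op ?B (2 * h + 1) f" if f: "f \<in> residue_bits M G" for f
  proof -
    obtain g where g: "g \<in> G" "f \<in> residue_bits M {g}" using f by (auto simp: residue_bits_def)
    then obtain a b where "a \<in> V'" "b \<in> V'" "nat_op a b g" using slp_layer by blast
    then show ?thesis using form_residue_of_nat_op[OF M _ _ _ g(2), of a V' b ?B] F by auto
  qed
  then have "slp bool_op (2 * h + 1) (card (residue_bits M G) * 4 ^ (2 * h + 1)) ?B (?B \<union> residue_bits M G)"
    using card_residue_bits[OF slp_layer(2)] by (intro slp_of_forms) auto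
  from slp_trans[OF this slp_layer.IH]
  show ?case
  proof (rule slp_weaken)
    show "residue_bits M (V' \<union> G) \<union> F \<subseteq> ?B \<union> residue_bits M G"
      by (auto simp: residue_bits_def)
    have "card (residue_bits M G) * 4 ^ (2 * h + 1) \<le> card G * M * M * 4 ^ (2 * h + 1)"
      using card_residue_bits[OF slp_layer(2)] by (intro mult_right_mono) auto
    then show "s * ?k + card (residue_bits M G) * 4 ^ (2 * h + 1) \<le> (s + card G) * ?k"
      by (simp add: algebra_simps)
  qed simp
next
  case (slp_weaken d s V V' V'' d' s')
  then have "residue_bits M V'' \<union> F \<subseteq> residue_bits M V' \<union> F" by (auto simp: residue_bits_def)
  with slp_weaken.IH show ?case
    by (rule slp.slp_weaken) (rule mult_le_mono1, fact)+
qed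

lemma slp_residues_of_inputs:
  "slp bool_op 1 ((N + 2) * M * M * 4) (bool_inputs N) (residue_bits M (nat_inputs N) \<union> bool_inputs N)"
proof -
  have const: "(\<lambda>x. b) \<in> bool_inputs N" for b by (cases b) (auto simp: bool_inputs_def)
  have fin: "finite (nat_inputs N)" by (simp add: nat_inputs_def)
  have "card (nat_inputs N) \<le> card ((\<lambda>i x. of_bool (x ! i) :: nat) ` {..<N}) + card {\<lambda>x::bool list. 0::nat, \<lambda>x. 1}"
    unfolding nat_inputs_def by (rule card_Un_le)
  also have "\<dots> \<le> N + 2"
    using card_image_le[of "{..<N}" "\<lambda>i x. of_bool (x ! i) :: nat"]
    by (intro add_mono) (auto simp: card_insert_if)
  finally have card: "card (nat_inputs N) \<le> N + 2" .
  have "form bool_op (bool_inputs N) 1 f" if f: "f \<in> residue_bits M (nat_inputs N)" for f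
  proof -
    obtain v m c where v: "v \<in> nat_inputs N" "m \<in> {1..M}" and fv: "f = (\<lambda>x. v x mod m = c)"
      using f by (auto simp: residue_bits_def)
    consider i where "i < N" "v = (\<lambda>x. of_bool (x ! i))" | k where "v = (\<lambda>x. k)"
      using v(1) by (auto simp: nat_inputs_def)
    then show ?thesis
    proof cases
      case (1 i)
      have inp: "form bool_op (bool_inputs N) 0 (\<lambda>x. x ! i)"
        using 1 by (auto intro!: form_base simp: bool_inputs_def)
      have "f = (\<lambda>x. if x ! i then 1 mod m = c else 0 = c)" unfolding fv 1(2) by auto
      then consider "f = (\<lambda>x. x ! i)" | "f = (\<lambda>x. \<not> x ! i)" | b where "f = (\<lambda>x. b)"
        by (cases "1 mod m = c"; cases "0 = c") auto
      then show ?thesis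
      proof cases
        case 1
        then show ?thesis using form_mono[OF inp] by simp
      next
        case 2
        then show ?thesis using form_not[OF inp] by simp
      next
        case 3
        then show ?thesis using const by (auto intro: form_base)
      qed
    next
      case 2
      then show ?thesis unfolding fv by (auto intro!: form_base const)
    qed
  qed
  then have "slp bool_op 1 (card (residue_bits M (nat_inputs N)) * 4 ^ 1) (bool_inputs N)
      (bool_inputs N \<union> residue_bits M (nat_inputs N))"
    using card_residue_bits[OF fin] by (intro slp_of_forms) auto
  then show ?thesis
  proof (rule slp_weaken)
    have "card (nat_inputs N) * M * M \<le> (N + 2) * M * M"
      using card by (intro mult_right_mono) auto
    then have "card (residue_bits M (nat_inputs N)) \<le> (N + 2) * M * M"
      using card_residue_bits(2)[OF fin, of M] by linarith
    then show "card (residue_bits M (nat_inputs N)) * 4 ^ 1 \<le> (N + 2) * M * M * 4"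
      by (simp only: power_one_right mult_le_mono1)
  qed auto
qed


section \<open>From Boolean programs to circuits\<close>

lemma gate_vals_snoc: "gate_vals (c @ [g]) x = gate_vals c x @ [gate_val x (gate_vals c x) g]"
  by (simp add: gate_vals_def)

lemma gate_depths_snoc: "gate_depths (c @ [g]) = gate_depths c @ [gate_depth (gate_depths c) g]"
  by (simp add: gate_depths_def)

lemma length_gate_vals [simp]: "length (gate_vals c x) = length c"
  by (induction c rule: rev_induct) (simp_all add: gate_vals_snoc, simp add: gate_vals_def)

lemma length_gate_depths [simp]: "length (gate_depths c) = length c"
  by (induction c rule: rev_induct) (simp_all add: gate_depths_snoc, simp add: gate_depths_def)

text \<open>
  Some gate of the circuit computes \<open>f\<close> in depth at most \<open>d\<close>. The depth is recorded for each function
  separately since the gates of a new layer appear one after another in the list, but must all be counted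
  from the previous layer.
\<close>

definition computes :: "circuit \<Rightarrow> nat \<Rightarrow> (bool list \<Rightarrow> bool) \<Rightarrow> bool" where
  "computes c d f \<longleftrightarrow> (\<exists>j < length c. gate_depths c ! j \<le> d \<and> (\<forall>x. gate_vals c x ! j = f x))"

lemma computes_snoc: "computes c d f \<Longrightarrow> computes (c @ [g]) d f"
  unfolding computes_def by (fastforce simp: gate_vals_snoc gate_depths_snoc nth_append less_Suc_eq)

lemma computes_mono: "computes c d f \<Longrightarrow> d \<le> d' \<Longrightarrow> computes c d' f"
  unfolding computes_def by (meson order.trans)

definition bounded_circuit :: "nat \<Rightarrow> nat \<Rightarrow> circuit \<Rightarrow> bool" where
  "bounded_circuit N d c \<longleftrightarrow> wf_circuit N c \<and> (\<forall>k \<in> set (gate_depths c). k \<le> d)"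

lemma bounded_circuit_snoc:
  assumes c: "bounded_circuit N d c" and g: "wf_gate N (length c) g" "gate_depth (gate_depths c) g \<le> d"
  shows "bounded_circuit N d (c @ [g])"
  using assms unfolding bounded_circuit_def wf_circuit_def
  by (auto simp: gate_depths_snoc nth_append less_Suc_eq)

lemma computes_last:
  "gate_depth (gate_depths c) g \<le> d \<Longrightarrow> (\<And>x. gate_val x (gate_vals c x) g = f x)
    \<Longrightarrow> computes (c @ [g]) d f"
  unfolding computes_def by (intro exI[of _ "length c"]) (simp add: gate_vals_snoc gate_depths_snoc nth_append)

lemma add_gate:
  assumes c: "bounded_circuit N (Suc d) c" and ab: "computes c d a" "computes c d b" and f: "bool_op a b f"
  obtains g where "bounded_circuit N (Suc d) (c @ [g])" "computes (c @ [g]) (Suc d) f"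
proof -
  obtain j k where j: "j < length c" "gate_depths c ! j \<le> d" "\<And>x. gate_vals c x ! j = a x"
    and k: "k < length c" "gate_depths c ! k \<le> d" "\<And>x. gate_vals c x ! k = b x"
    using ab unfolding computes_def by blast
  define g where "g = (if f = (\<lambda>x. \<not> a x) then Neg j
    else if f = (\<lambda>x. a x \<and> b x) then Conj j k else Disj j k)"
  have g: "wf_gate N (length c) g" "gate_depth (gate_depths c) g \<le> Suc d"
    using j k by (auto simp: g_def)
  moreover have "gate_val x (gate_vals c x) g = f x" for x
    using f j(3) k(3) unfolding bool_op_def g_def by auto
  ultimately show ?thesis using that[of g] bounded_circuit_snoc[OF c] computes_last by blast
qed

lemma add_layer:
  assumes c: "bounded_circuit N d c" and F: "\<And>f. f \<in> F \<Longrightarrow> computes c d f"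
    and G: "finite G" "\<And>g. g \<in> G \<Longrightarrow> \<exists>a\<in>F. \<exists>b\<in>F. bool_op a b g"
  obtains c' where "bounded_circuit N (Suc d) c'" "length c' = length c + card G"
    "\<And>f. f \<in> F \<Longrightarrow> computes c' d f" "\<And>f. f \<in> G \<Longrightarrow> computes c' (Suc d) f"
proof -
  have "\<exists>c'. bounded_circuit N (Suc d) c' \<and> length c' = length c + card G
      \<and> (\<forall>f\<in>F. computes c' d f) \<and> (\<forall>f\<in>G. computes c' (Suc d) f)"
    using G
  proof (induction G rule: finite_induct)
    case empty
    have "bounded_circuit N (Suc d) c" using c unfolding bounded_circuit_def by auto
    then show ?case using F by auto
  next
    case (insert g G)
    then obtain c' where c': "bounded_circuit N (Suc d) c'" "length c' = length c + card G"
      "\<And>f. f \<in> F \<Longrightarrow> computes c' d f" "\<And>f. f \<in> G \<Longrightarrow> computes c' (Suc d) f" by auto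
    obtain a b where ab: "a \<in> F" "b \<in> F" "bool_op a b g" using insert.prems by blast
    obtain h where h: "bounded_circuit N (Suc d) (c' @ [h])" "computes (c' @ [h]) (Suc d) g"
      using add_gate[OF c'(1) c'(3)[OF ab(1)] c'(3)[OF ab(2)] ab(3)] .
    show ?case
      by (rule exI[of _ "c' @ [h]"]) (use h c' computes_snoc insert in auto)
  qed
  then show ?thesis using that by blast
qed

lemma circuit_of_slp:
  assumes "slp bool_op d s F F'" and F: "F = bool_inputs N"
  obtains c where "bounded_circuit N d c" "length c \<le> N + 2 + s" "\<And>f. f \<in> F' \<Longrightarrow> computes c d f"
proof -
  have "\<exists>c. bounded_circuit N d c \<and> length c \<le> N + 2 + s \<and> (\<forall>f\<in>F'. computes c d f)"
    using assms
  proof (induction rule: slp.induct)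
    case (slp_refl F)
    define ins where "ins = (\<lambda>k. map Input [0..<k])"
    have ins: "gate_depths (ins k) = replicate k 0 \<and> gate_vals (ins k) x = map (\<lambda>j. x ! j) [0..<k]" for k x
      by (induction k) (simp_all add: ins_def gate_vals_snoc gate_depths_snoc replicate_append_same,
          simp add: gate_depths_def gate_vals_def)
    \<comment> \<open>The constants serve as values of empty conjunctions and disjunctions.\<close>
    define c where "c = ins N @ [Konst True] @ [Konst False]"
    have len: "length (ins N) = N" by (simp add: ins_def)
    have dep: "gate_depths c = replicate N 0 @ [0, 0]"
      and val: "gate_vals c x = map (\<lambda>j. x ! j) [0..<N] @ [True, False]" for x
      using ins[of N] unfolding c_def append_assoc[symmetric] gate_depths_snoc gate_vals_snoc by auto
    have "wf_circuit N c"
      by (auto simp: wf_circuit_def c_def ins_def nth_append less_Suc_eq)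
    then have "bounded_circuit N 0 c" by (simp add: bounded_circuit_def dep)
    moreover have "length c \<le> N + 2 + 0" by (simp add: c_def len)
    moreover have "computes c 0 f" if "f \<in> F" for f
    proof -
      have "f \<in> (\<lambda>i x. x ! i) ` {..<N} \<or> f = (\<lambda>x. True) \<or> f = (\<lambda>x. False)"
        using that slp_refl by (auto simp: bool_inputs_def)
      then consider i where "i < N" "f = (\<lambda>x. x ! i)" | "f = (\<lambda>x. True)" | "f = (\<lambda>x. False)" by blast
      then show ?thesis
      proof cases
        case (1 i)
        then show ?thesis unfolding computes_def dep val
          by (intro exI[of _ i]) (simp add: nth_append c_def len)
      next
        case 2
        then show ?thesis unfolding computes_def dep val
          by (intro exI[of _ N]) (simp add: nth_append c_def len)
      next
        case 3
        then show ?thesis unfolding computes_def dep val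
          by (intro exI[of _ "Suc N"]) (simp add: nth_append c_def len)
      qed
    qed
    ultimately show ?case by blast
  next
    case (slp_layer d s F F' G)
    then obtain c where c: "bounded_circuit N d c" "length c \<le> N + 2 + s" "\<And>f. f \<in> F' \<Longrightarrow> computes c d f"
      by blast
    obtain c' where c': "bounded_circuit N (Suc d) c'" "length c' = length c + card G"
      "\<And>f. f \<in> F' \<Longrightarrow> computes c' d f" "\<And>f. f \<in> G \<Longrightarrow> computes c' (Suc d) f"
      by (rule add_layer[OF c(1) c(3) slp_layer(2,3)]) auto
    then have "computes c' (Suc d) f" if "f \<in> F' \<union> G" for f
      using that computes_mono[of c' d f "Suc d"] by auto
    then show ?case using c c' by (intro exI[of _ c']) auto
  next
    case (slp_weaken d s F F' F'' d' s')
    then obtain c where c: "bounded_circuit N d c" "length c \<le> N + 2 + s" "\<And>f. f \<in> F' \<Longrightarrow> computes c d f"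
      by blast
    have "bounded_circuit N d' c"
      using c(1) slp_weaken(3) unfolding bounded_circuit_def by (meson order.trans)
    then show ?case
      using c(2,3) slp_weaken computes_mono[OF c(3) slp_weaken(3)] by (intro exI[of _ c]) auto
  qed
  then show ?thesis using that by blast
qed

text \<open>
  The output has to be the last gate; a disjunction of the desired gate with itself serves as a copy.
\<close>

lemma circuit_output_of_slp:
  assumes "slp bool_op d s (bool_inputs N) F" "f \<in> F"
  obtains c where "wf_circuit N c" "circuit_size c \<le> N + 3 + s" "circuit_depth c \<le> Suc d"
    "\<And>x. circuit_output c x = f x"
proof -
  obtain c where c: "bounded_circuit N d c" "length c \<le> N + 2 + s" "computes c d f"
    using circuit_of_slp[OF assms(1) refl] assms(2) by metis
  obtain j where j: "j < length c" "gate_depths c ! j \<le> d" "\<And>x. gate_vals c x ! j = f x"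
    using c(3) unfolding computes_def by blast
  have "bounded_circuit N (Suc d) c" using c(1) unfolding bounded_circuit_def by auto
  then have "bounded_circuit N (Suc d) (c @ [Disj j j])"
    by (rule bounded_circuit_snoc) (use j in auto)
  then have "wf_circuit N (c @ [Disj j j])" "circuit_depth (c @ [Disj j j]) \<le> Suc d"
    unfolding bounded_circuit_def circuit_depth_def by (auto simp: gate_depths_snoc)
  moreover have "circuit_output (c @ [Disj j j]) x = f x" for x
    by (simp add: circuit_output_def gate_vals_snoc j)
  moreover have "circuit_size (c @ [Disj j j]) \<le> N + 3 + s" using c(2) by (simp add: circuit_size_def)
  ultimately show ?thesis using that by blast
qed


section \<open>A circuit comparing the numbers of closed walks\<close>

text \<open>
  The adjacency matrix stored row by row in the input from position \<open>off\<close> on.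
\<close>

definition bit_arc :: "nat \<Rightarrow> nat \<Rightarrow> bool list \<Rightarrow> nat \<Rightarrow> nat \<Rightarrow> bool" where
  "bit_arc n off x u v = x ! (off + u * n + v)"

definition walk_functions :: "nat \<Rightarrow> nat set \<Rightarrow> nat \<Rightarrow> (bool list \<Rightarrow> nat) set" where
  "walk_functions n S K =
     (\<lambda>(off, k, u, v) x. walks {..<n} (bit_arc n off x) k u v) ` (S \<times> {..K} \<times> {..<n} \<times> {..<n})"

lemma walk_functionsI:
  "off \<in> S \<Longrightarrow> k \<le> K \<Longrightarrow> u < n \<Longrightarrow> v < n \<Longrightarrow>
    (\<lambda>x. walks {..<n} (bit_arc n off x) k u v) \<in> walk_functions n S K"
  unfolding walk_functions_def by (rule image_eqI[of _ _ "(off, k, u, v)"]) auto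

lemma card_walk_functions:
  assumes "finite S"
  shows "finite (walk_functions n S K)" "card (walk_functions n S K) \<le> card S * Suc K * n * n"
proof -
  show "finite (walk_functions n S K)" using assms by (simp add: walk_functions_def)
  have "card (walk_functions n S K) \<le> card (S \<times> {..K} \<times> {..<n} \<times> {..<n})"
    unfolding walk_functions_def using assms by (intro card_image_le) auto
  then show "card (walk_functions n S K) \<le> card S * Suc K * n * n"
    by (simp add: card_cartesian_product algebra_simps)
qed

text \<open>
  A walk of length at most \<open>2 * K\<close> is split into two walks of length at most \<open>K\<close>.
\<close>

lemma form_walks_add:
  assumes V: "walk_functions n S K \<subseteq> V" "(\<lambda>x. 0) \<in> V" and n: "n \<le> 2 ^ h"
    and f: "f \<in> walk_functions n S (2 * K)"
  shows "form nat_op V (1 + h) f"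
proof -
  obtain off k u v where *: "off \<in> S" "k \<le> 2 * K" "u < n" "v < n"
    and f: "f = (\<lambda>x. walks {..<n} (bit_arc n off x) k u v)"
    using f unfolding walk_functions_def by auto
  \<comment> \<open>For \<open>k \<le> K\<close> the second walk has length \<open>0\<close>.\<close>
  define a b where "a = min k K" and "b = k - a"
  have ab: "k = a + b" "a \<le> K" "b \<le> K" using * by (auto simp: a_def b_def)
  have "f = (\<lambda>x. \<Sum>w<n. walks {..<n} (bit_arc n off x) a u w * walks {..<n} (bit_arc n off x) b w v)"
    unfolding f ab(1) using * by (subst walks_add) auto
  moreover have "form nat_op V (Suc 0)
      (\<lambda>x. walks {..<n} (bit_arc n off x) a u w * walks {..<n} (bit_arc n off x) b w v)" if "w < n" for w
    by (rule form_op[of _ _ _ "\<lambda>x. walks {..<n} (bit_arc n off x) a u w"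
          "\<lambda>x. walks {..<n} (bit_arc n off x) b w v"])
       (use * ab that in \<open>auto simp: nat_op_def intro!: form_base subsetD[OF V(1)] walk_functionsI\<close>)
  ultimately show ?thesis using form_sum[of V "{..<n}" 1 _ h] V(2) n by simp
qed

text \<open>
  Repeated squaring. It starts with the walks of length at most \<open>1\<close>, whose numbers are constants or
  input bits.
\<close>

lemma slp_walk_functions:
  assumes S: "finite S" "\<And>off. off \<in> S \<Longrightarrow> off + n * n \<le> N" and n: "n \<le> 2 ^ h"
  shows "slp nat_op (t * (1 + h)) (t * (card S * Suc (2 ^ t) * n * n * 4 ^ (1 + h)))
    (nat_inputs N) (walk_functions n S (2 ^ t) \<union> nat_inputs N)"
proof (induction t)
  case 0
  have "f \<in> nat_inputs N" if f: "f \<in> walk_functions n S 1" for f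
  proof -
    obtain off k u v where *: "off \<in> S" "k \<le> 1" "u < n" "v < n"
      and f: "f = (\<lambda>x. walks {..<n} (bit_arc n off x) k u v)"
      using f unfolding walk_functions_def by auto
    show ?thesis
    proof (cases "k = 0")
      case True
      then show ?thesis unfolding f by (cases "u = v") (auto simp: nat_inputs_def)
    next
      case False
      then have "k = Suc 0" using * by simp
      then have "f = (\<lambda>x. of_bool (x ! (off + u * n + v)))"
        unfolding f using * by (simp add: bit_arc_def of_bool_def if_distrib[of "\<lambda>y. _ * y"] cong: if_cong)
      moreover have "off + u * n + v < N"
      proof -
        have "Suc u * n \<le> n * n" using * by (intro mult_right_mono) auto
        then show ?thesis using S(2)[OF *(1)] * by simp
      qed
      ultimately show ?thesis unfolding nat_inputs_def by blast
    qed
  qed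
  then show ?case by (intro slp_weaken[OF slp_refl]) auto
next
  case (Suc t)
  let ?V = "walk_functions n S (2 ^ t) \<union> nat_inputs N" and ?W = "walk_functions n S (2 ^ Suc t)"
  note card = card_walk_functions[OF S(1), of n "2 ^ Suc t"]
  have "slp nat_op (1 + h) (card ?W * 4 ^ (1 + h)) ?V (?V \<union> ?W)"
    using card(1) by (rule slp_of_forms) (rule form_walks_add[OF _ _ n], auto simp: nat_inputs_def)
  from slp_trans[OF this Suc.IH] show ?case
  proof (rule slp_weaken)
    have "card ?W * 4 ^ (1 + h) \<le> card S * Suc (2 ^ Suc t) * n * n * 4 ^ (1 + h)"
      using card(2) by (rule mult_right_mono) simp
    moreover have "t * (card S * Suc (2 ^ t) * n * n * 4 ^ (1 + h))
        \<le> t * (card S * Suc (2 ^ Suc t) * n * n * 4 ^ (1 + h))"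
      by (intro mult_le_mono le_refl) simp
    ultimately show "t * (card S * Suc (2 ^ t) * n * n * 4 ^ (1 + h)) + card ?W * 4 ^ (1 + h)
        \<le> Suc t * (card S * Suc (2 ^ Suc t) * n * n * 4 ^ (1 + h))"
      unfolding mult_Suc by linarith
  qed auto
qed

definition closed_walk_functions :: "nat \<Rightarrow> nat set \<Rightarrow> nat \<Rightarrow> (bool list \<Rightarrow> nat) set" where
  "closed_walk_functions n S K = (\<lambda>(off, k) x. closed_walks {..<n} (bit_arc n off x) k) ` (S \<times> {..K})"

lemma slp_closed_walk_functions:
  assumes S: "finite S" "\<And>off. off \<in> S \<Longrightarrow> off + n * n \<le> N" and n: "n \<le> 2 ^ h"
  shows "slp nat_op (t * (1 + h) + h)
    (t * (card S * Suc (2 ^ t) * n * n * 4 ^ (1 + h)) + card S * Suc (2 ^ t) * 4 ^ h)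
    (nat_inputs N) (closed_walk_functions n S (2 ^ t))"
proof -
  let ?V = "walk_functions n S (2 ^ t) \<union> nat_inputs N" and ?W = "closed_walk_functions n S (2 ^ t)"
  have "card ?W \<le> card (S \<times> {..2 ^ t :: nat})"
    unfolding closed_walk_functions_def using S by (intro card_image_le) auto
  then have card: "card ?W \<le> card S * Suc (2 ^ t)" by (simp add: card_cartesian_product)
  have "form nat_op ?V h f" if f: "f \<in> ?W" for f
  proof -
    obtain off k where *: "off \<in> S" "k \<le> 2 ^ t" and f: "f = (\<lambda>x. \<Sum>u<n. walks {..<n} (bit_arc n off x) k u u)"
      using f unfolding closed_walk_functions_def closed_walks_def by auto
    have "form nat_op ?V (0 + h) f" unfolding f
      by (rule form_sum) (use * n in \<open>auto simp: nat_inputs_def intro!: form_base walk_functionsI\<close>)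
    then show ?thesis by simp
  qed
  then have "slp nat_op h (card ?W * 4 ^ h) ?V (?V \<union> ?W)"
    using S(1) by (intro slp_of_forms) (auto simp: closed_walk_functions_def)
  from slp_trans[OF this slp_walk_functions[OF S n, of t]] show ?thesis
    by (rule slp_weaken) (use card mult_right_mono[OF card, of "4 ^ h"] in auto)
qed

text \<open>
  The predicate to be computed on inputs of length \<open>2 * (n * n + n + 1)\<close>: the first encoded order is \<open>n\<close>,
  and the graphs stored from positions \<open>a\<close> and \<open>b\<close> on have the same numbers of closed walks.
\<close>

definition same_closed_walks_bits :: "nat \<Rightarrow> nat \<Rightarrow> nat \<Rightarrow> bool list \<Rightarrow> bool" where
  "same_closed_walks_bits n a b x \<longleftrightarrow> (\<forall>i<n. x ! i) \<and> \<not> x ! n \<and>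
     (\<forall>k\<le>2 * n. closed_walks {..<n} (bit_arc n a x) k = closed_walks {..<n} (bit_arc n b x) k)"

text \<open>
  The numbers of closed walks are at most \<open>n ^ (2 * n + 1)\<close>, hence determined by their residues modulo
  \<open>1, \<dots>, M\<close>.
\<close>

lemma closed_walks_eq_iff_residues:
  assumes n: "n \<le> 2 ^ L" and k: "k \<le> 2 * n" and M: "L * (2 * n + 1) + 1 < M"
  shows "closed_walks {..<n} E k = closed_walks {..<n} E' k \<longleftrightarrow>
    (\<forall>m\<in>{1..M}. \<exists>c<m. closed_walks {..<n} E k mod m = c \<and> closed_walks {..<n} E' k mod m = c)"
proof -
  have bound: "closed_walks {..<n} E k < 2 ^ (M - 1)" for E
  proof (cases "n = 0")
    case True
    then show ?thesis by (simp add: closed_walks_def)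
  next
    case False
    have "closed_walks {..<n} E k \<le> n ^ Suc k" using closed_walks_le[of "{..<n}" E k] by simp
    also have "\<dots> \<le> n ^ (2 * n + 1)" using k False by (intro power_increasing) auto
    also have "\<dots> \<le> (2 ^ L) ^ (2 * n + 1)" using n by (rule power_mono) simp
    also have "\<dots> = 2 ^ (L * (2 * n + 1))" by (simp only: power_mult)
    also have "\<dots> < 2 ^ (M - 1)" using M by (intro power_strict_increasing) auto
    finally show ?thesis .
  qed
  have "closed_walks {..<n} E k = closed_walks {..<n} E' k"
    if *: "\<forall>m\<in>{1..M}. closed_walks {..<n} E k mod m = closed_walks {..<n} E' k mod m"
    by (rule eq_if_small_residues_eq[of _ "M - 1"]) (use bound * M in auto)
  then show ?thesis by auto
qed

lemma form_same_closed_walks_bits: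
  assumes nN: "n < N" and n: "n \<le> 2 ^ L" "2 * n + 1 \<le> 2 ^ q" and M: "M \<le> 2 ^ h" "L * (2 * n + 1) + 1 < M"
    and F: "bool_inputs N \<subseteq> F" "residue_bits M (closed_walk_functions n {a, b} K) \<subseteq> F" and K: "2 * n \<le> K"
  shows "form bool_op F (2 * h + q + L + 4) (same_closed_walks_bits n a b)"
proof -
  let ?c = "\<lambda>off k x. closed_walks {..<n} (bit_arc n off x) k"
  have const: "(\<lambda>x. True) \<in> F" "(\<lambda>x. False) \<in> F" and inp: "(\<lambda>x. x ! i) \<in> F" if "i < N" for i
    using F(1) that by (auto simp: bool_inputs_def)
  have const: "(\<lambda>x. True) \<in> F" "(\<lambda>x. False) \<in> F" using const[OF nN] .
  have bit: "(\<lambda>x. ?c off k x mod m = i) \<in> F" if "off \<in> {a, b}" "k \<le> 2 * n" "m \<in> {1..M}" "i < m" for off k m i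
  proof -
    have "?c off k \<in> closed_walk_functions n {a, b} K"
      unfolding closed_walk_functions_def by (rule image_eqI[of _ _ "(off, k)"]) (use that K in auto)
    then have "(\<lambda>x. ?c off k x mod m = i) \<in> residue_bits M (closed_walk_functions n {a, b} K)"
      unfolding residue_bits_def using that
      by (intro CollectI bexI[of _ "?c off k"] bexI[of _ m] exI[of _ i]) auto
    then show ?thesis using F(2) by blast
  qed
  have "form bool_op F (((Suc 0 + h) + h) + q) (\<lambda>x. \<forall>k\<in>{..2 * n}. \<forall>m\<in>{1..M}. \<exists>i\<in>{..<m}.
      ?c a k x mod m = i \<and> ?c b k x mod m = i)"
    by (intro form_All form_Ex form_conj form_base bit const) (use M n in auto)
  then have 1: "form bool_op F (2 * h + q + L + 2) (\<lambda>x. \<forall>k\<in>{..2 * n}. \<forall>m\<in>{1..M}. \<exists>i\<in>{..<m}.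
      ?c a k x mod m = i \<and> ?c b k x mod m = i)"
    by (rule form_mono) simp
  have "form bool_op F (0 + L) (\<lambda>x. \<forall>i\<in>{..<n}. x ! i)"
    by (intro form_All form_base inp const) (use nN n in auto)
  then have 2: "form bool_op F (2 * h + q + L + 3) (\<lambda>x. \<forall>i\<in>{..<n}. x ! i)"
    by (rule form_mono) simp
  have "form bool_op F (Suc 0) (\<lambda>x. \<not> x ! n)" by (intro form_not form_base inp nN)
  then have "form bool_op F (2 * h + q + L + 2) (\<lambda>x. \<not> x ! n)" by (rule form_mono) simp
  from form_conj[OF this 1]
  have 3: "form bool_op F (2 * h + q + L + 3) (\<lambda>x. \<not> x ! n \<and> (\<forall>k\<in>{..2 * n}. \<forall>m\<in>{1..M}. \<exists>i\<in>{..<m}.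
      ?c a k x mod m = i \<and> ?c b k x mod m = i))" by (simp add: numeral_eq_Suc)
  have "same_closed_walks_bits n a b = (\<lambda>x. (\<forall>i\<in>{..<n}. x ! i) \<and> \<not> x ! n \<and>
      (\<forall>k\<in>{..2 * n}. \<forall>m\<in>{1..M}. \<exists>i\<in>{..<m}. ?c a k x mod m = i \<and> ?c b k x mod m = i))"
    unfolding same_closed_walks_bits_def fun_eq_iff
    using closed_walks_eq_iff_residues[OF n(1) _ M(2)] by (auto simp: Ball_def Bex_def)
  with form_conj[OF 2 3] show ?thesis by (simp add: numeral_eq_Suc)
qed

text \<open>
  The estimates are expressed by \<open>P = 2 ^ (L + 3)\<close>, which is linear in \<open>n\<close>: all the numbers of
  indices, residues and rounds are bounded by \<open>P\<close> or \<open>P\<^sup>2\<close>, and formulas of depth proportional to \<open>L + 3\<close>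
  have a size bounded by a power of \<open>P\<close>. The offsets are those of the adjacency matrices in the
  concatenated codes of two graphs of order \<open>n\<close>.
\<close>

lemma same_closed_walks_circuit:
  assumes n: "n > 0" "n \<le> 2 ^ L" and L: "2 ^ L \<le> 2 * n" and N: "N = 2 * (n * n + n + 1)"
  obtains c where "wf_circuit N c" "circuit_size c \<le> 2 ^ (21 * (L + 3))" "circuit_depth c \<le> 20 * (L + 3) ^ 3"
    "\<And>x. circuit_output c x = same_closed_walks_bits n (n + 1) (n * n + n + 1 + (n + 1)) x"
proof -
  define a b where "a = n + 1" and "b = n * n + n + 1 + (n + 1)"
  define l where "l = L + 3"
  define P where "P = (2::nat) ^ l"
  have P8: "P = 8 * 2 ^ L" by (simp add: P_def l_def power_add)
  have Pn: "4 * (2 * n + 1) \<le> P * 2" "n \<le> P" using n unfolding P8 by auto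
  have pow: "(2::nat) ^ (c * l) = P ^ c" for c by (simp add: P_def power_mult mult.commute[of c])
  \<comment> \<open>Numbers of closed walks are less than \<open>2 ^ (M - 1)\<close>.\<close>
  define M where "M = P ^ 2"
  define h where "h = 2 * l"
  have Mh: "M = 2 ^ h" unfolding M_def h_def pow ..
  have LP: "L < 2 ^ L" by (rule less_exp)
  have residue_bound: "L * (2 * n + 1) + 1 < M"
  proof -
    have X: "X * (2 * X + 1) + 1 < (8 * X) ^ 2" if "X > 0" for X :: nat
    proof -
      have "X * 1 \<le> X * X" "1 * 1 \<le> X * X" using that by (intro mult_le_mono; simp)+
      then show ?thesis unfolding power2_eq_square distrib_left by linarith
    qed
    have "L * (2 * n + 1) + 1 \<le> 2 ^ L * (2 * 2 ^ L + 1) + 1"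
      using LP n by (intro add_mono mult_mono) auto
    also have "\<dots> < (8 * 2 ^ L) ^ 2" by (rule X) simp
    finally show ?thesis by (simp add: M_def P8)
  qed
  have card_ab: "card {a, b} \<le> 2" by (simp add: card_insert_if)
  have offs: "off + n * n \<le> N" if "off \<in> {a, b}" for off using that by (auto simp: a_def b_def N)
  \<comment> \<open>After \<open>T\<close> squarings the exponents reach \<open>2 * 2 ^ L \<ge> 2 * n\<close>.\<close>
  define T where "T = L + 1"
  define D where "D = T * (1 + L) + L"
  define s where "s = T * (card {a, b} * Suc (2 ^ T) * n * n * 4 ^ (1 + L)) + card {a, b} * Suc (2 ^ T) * 4 ^ L"
  let ?W = "closed_walk_functions n {a, b} (2 ^ T)"
  have slpW: "slp nat_op D s (nat_inputs N) ?W"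
    unfolding D_def s_def by (rule slp_closed_walk_functions[OF _ offs n(2)]) auto
  define k where "k = 2 * h + 1"
  have slp1: "slp bool_op (D * k) (s * (M * M * 4 ^ k))
     (residue_bits M (nat_inputs N) \<union> bool_inputs N) (residue_bits M ?W \<union> bool_inputs N)"
    unfolding k_def by (rule slp_bool_of_slp_nat[OF slpW]) (simp_all add: Mh bool_inputs_def)
  note slp2 = slp_trans[OF slp1 slp_residues_of_inputs]
  let ?F = "residue_bits M ?W \<union> bool_inputs N"
  define r where "r = 2 * h + l + L + 4"
  have "2 * n + 1 \<le> 2 ^ l" using Pn by (simp add: P_def)
  then have "form bool_op ?F r (same_closed_walks_bits n a b)"
    unfolding r_def using residue_bound n N
    by (intro form_same_closed_walks_bits[where K = "2 ^ T" and M = M and N = N]) (auto simp: Mh T_def)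
  then have "slp bool_op r (card {same_closed_walks_bits n a b} * 4 ^ r) ?F (?F \<union> {same_closed_walks_bits n a b})"
    by (intro slp_of_forms) auto
  from slp_trans[OF this slp2]
  have "slp bool_op (1 + D * k + r) ((N + 2) * M * M * 4 + s * (M * M * 4 ^ k) + 4 ^ r)
      (bool_inputs N) (?F \<union> {same_closed_walks_bits n a b})" by simp
  then obtain c where c: "wf_circuit N c"
    "circuit_size c \<le> N + 3 + ((N + 2) * M * M * 4 + s * (M * M * 4 ^ k) + 4 ^ r)"
    "circuit_depth c \<le> Suc (1 + D * k + r)" "\<And>x. circuit_output c x = same_closed_walks_bits n a b x"
    by (rule circuit_output_of_slp) auto
  have l3: "l \<ge> 3" by (simp add: l_def)
  have P1: "P \<ge> 8" using one_le_power[of "2::nat" L] unfolding P8 by simp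
  have depth: "Suc (1 + D * k + r) \<le> 20 * l ^ 3"
  proof -
    have "D \<le> l * l" by (simp add: D_def T_def l_def algebra_simps)
    moreover have "k \<le> 5 * l" using l3 by (simp add: k_def h_def)
    ultimately have "D * k \<le> (l * l) * (5 * l)" by (rule mult_mono) auto
    moreover have "r \<le> 7 * l" using l3 by (simp add: r_def h_def l_def)
    moreover have "l * 1 \<le> l * (l * l)" using l3 by (intro mult_left_mono) (simp_all add: Suc_le_eq)
    moreover have "(l * l) * (5 * l) = 5 * (l * (l * l))" "l ^ 3 = l * (l * l)"
      by (simp_all add: power3_eq_cube)
    ultimately show ?thesis using l3 by linarith
  qed
  have size: "N + 3 + ((N + 2) * M * M * 4 + s * (M * M * 4 ^ k) + 4 ^ r) \<le> P ^ 21"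
  proof -
    have "N + 3 \<le> P ^ 2"
    proof -
      have "n \<le> n * n" "1 \<le> n * n" using n(1) by simp_all
      then have "2 * (n * n) + 2 * n + 5 \<le> 9 * (n * n)" by linarith
      then have "N + 3 \<le> 9 * (n * n)" unfolding N by (simp add: algebra_simps)
      also have "\<dots> \<le> (8 * n) * (8 * n)" by simp
      also have "\<dots> \<le> P * P" using n unfolding P8 by (intro mult_mono) auto
      finally show ?thesis by (simp add: power2_eq_square)
    qed
    note NP = this
    have T2: "card {a, b} * Suc (2 ^ T) \<le> P"
    proof -
      have "card {a, b} * Suc (2 ^ T) \<le> 2 * Suc (2 ^ T)" using card_ab by (rule mult_right_mono) simp
      also have "\<dots> \<le> P" using one_le_power[of "2::nat" L] by (simp add: P8 T_def)
      finally show ?thesis .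
    qed
    have fourL: "(4::nat) ^ (1 + L) \<le> P ^ 2"
    proof -
      have "(4::nat) ^ (1 + L) = 2 ^ (2 * (1 + L))" by (simp only: power_mult) simp
      also have "\<dots> \<le> 2 ^ (2 * l)" by (rule power_increasing) (simp_all add: l_def)
      finally show ?thesis by (simp only: pow)
    qed
    have "T \<le> P" using LP unfolding T_def P8 by linarith
    have "T * (card {a, b} * Suc (2 ^ T) * n * n * 4 ^ (1 + L)) \<le> P * (P * P * P * P ^ 2)"
      by (intro mult_le_mono \<open>T \<le> P\<close> T2 Pn(2) fourL)
    moreover have "card {a, b} * Suc (2 ^ T) * 4 ^ L \<le> P * P ^ 2"
      by (intro mult_le_mono T2 order.trans[OF _ fourL]) simp
    moreover have "P * P ^ 2 \<le> P ^ 6"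
      using power_increasing[of 3 6 P] P1 by (simp add: numeral_eq_Suc mult_ac)
    moreover have "P * (P * P * P * P ^ 2) = P ^ 6" by (simp add: numeral_eq_Suc mult_ac)
    ultimately have "s \<le> P ^ 6 + P ^ 6" unfolding s_def by linarith
    also have "\<dots> = 2 * P ^ 6" by simp
    also have "\<dots> \<le> P * P ^ 6" using P1 by (intro mult_right_mono) auto
    finally have s: "s \<le> P ^ 7" by (simp add: numeral_eq_Suc)
    have "(4::nat) ^ k = 2 ^ (2 * k)" by (simp only: power_mult) simp
    also have "\<dots> \<le> 2 ^ (9 * l)" by (rule power_increasing) (use l3 in \<open>simp_all add: k_def h_def\<close>)
    finally have k4: "4 ^ k \<le> P ^ 9" by (simp only: pow)
    have "(4::nat) ^ r = 2 ^ (2 * r)" by (simp only: power_mult) simp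
    also have "\<dots> \<le> 2 ^ (14 * l)" by (rule power_increasing) (use l3 in \<open>simp_all add: r_def h_def l_def\<close>)
    finally have r4: "4 ^ r \<le> P ^ 14" by (simp only: pow)
    have "s * (M * M * 4 ^ k) \<le> P ^ 7 * (P ^ 2 * P ^ 2 * P ^ 9)"
      unfolding M_def by (intro mult_le_mono s k4 le_refl)
    also have "\<dots> = P ^ 20" by (simp flip: power_add)
    finally have t1: "s * (M * M * 4 ^ k) \<le> P ^ 20" .
    have "(N + 2) * M * M * 4 \<le> P ^ 2 * P ^ 2 * P ^ 2 * P"
      unfolding M_def by (intro mult_le_mono le_refl) (use NP P1 in auto)
    also have "\<dots> = P ^ 7" by (simp add: numeral_eq_Suc mult_ac)
    also have "\<dots> \<le> P ^ 20" using P1 by (intro power_increasing) auto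
    finally have t2: "(N + 2) * M * M * 4 \<le> P ^ 20" .
    have t3: "4 ^ r \<le> P ^ 20" by (rule order.trans[OF r4]) (use P1 in \<open>auto intro: power_increasing\<close>)
    have t4: "N + 3 \<le> P ^ 20" by (rule order.trans[OF NP]) (use P1 in \<open>auto intro: power_increasing\<close>)
    have "N + 3 + ((N + 2) * M * M * 4 + s * (M * M * 4 ^ k) + 4 ^ r) \<le> 8 * P ^ 20"
      using t1 t2 t3 t4 by linarith
    also have "\<dots> \<le> P * P ^ 20" using P1 by (intro mult_right_mono) auto
    finally show ?thesis by (simp add: numeral_eq_Suc)
  qed
  show ?thesis
  proof (rule that[OF c(1)])
    show "circuit_size c \<le> 2 ^ (21 * (L + 3))" using c(2) size pow[of 21] by (simp add: l_def)
    show "circuit_depth c \<le> 20 * (L + 3) ^ 3" using c(3) depth by (simp add: l_def)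
  qed (use c(4) in \<open>simp add: a_def b_def\<close>)
qed


lemma ex_tight_power_of_two:
  assumes "n > (0::nat)"
  obtains L where "n \<le> 2 ^ L" "2 ^ L \<le> 2 * n"
proof -
  define L where "L = (LEAST L. n \<le> 2 ^ L)"
  have "n \<le> 2 ^ n" using less_exp[of n] by simp
  then have 1: "n \<le> 2 ^ L" unfolding L_def by (rule LeastI)
  have "2 ^ L \<le> 2 * n"
  proof (cases L)
    case 0
    then show ?thesis using assms by simp
  next
    case (Suc K)
    then have "\<not> n \<le> 2 ^ K" using not_less_Least[of K "\<lambda>L. n \<le> 2 ^ L"] unfolding L_def by simp
    then show ?thesis using Suc by simp
  qed
  with 1 that show ?thesis by blast
qed

lemma input_length_inj:
  fixes n m :: nat
  assumes "n * n + n + 1 = m * m + m + 1"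
  shows "n = m"
proof -
  have "\<not> a < b" if "a * a + a + 1 = b * b + b + 1" for a b :: nat
  proof
    assume "a < b"
    then have "a * a \<le> b * b" by (intro mult_le_mono) auto
    then show False using that \<open>a < b\<close> by linarith
  qed
  from this[OF assms] this[OF assms[symmetric]] show ?thesis by simp
qed

text \<open>
  An input length determines the order \<open>n\<close> if both graphs have the same order. Inputs of any
  other length consist of graphs of different orders and are rejected by a constant circuit.
\<close>

lemma same_closed_walks_circuit_family:
  obtains C where "\<And>N. wf_circuit N (C N)"
    "\<And>N. N \<ge> 3 \<Longrightarrow> circuit_size (C N) \<le> (8 * N) ^ 21"
    "\<And>N. N \<ge> 3 \<Longrightarrow> real (circuit_depth (C N)) \<le> 2500 * ln (real N) ^ 3"
    "\<And>N x. (\<And>n. n > 0 \<Longrightarrow> N \<noteq> 2 * (n * n + n + 1)) \<Longrightarrow> \<not> circuit_output (C N) x"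
    "\<And>n x. n > 0 \<Longrightarrow> circuit_output (C (2 * (n * n + n + 1))) x \<longleftrightarrow>
       same_closed_walks_bits n (n + 1) (n * n + n + 1 + (n + 1)) x"
proof -
  define good where "good N c \<longleftrightarrow> wf_circuit N c
    \<and> (N \<ge> 3 \<longrightarrow> circuit_size c \<le> (8 * N) ^ 21 \<and> real (circuit_depth c) \<le> 2500 * ln (real N) ^ 3)
    \<and> ((\<forall>n>0. N \<noteq> 2 * (n * n + n + 1)) \<longrightarrow> (\<forall>x. \<not> circuit_output c x))
    \<and> (\<forall>n>0. N = 2 * (n * n + n + 1) \<longrightarrow> (\<forall>x. circuit_output c x \<longleftrightarrow>
         same_closed_walks_bits n (n + 1) (n * n + n + 1 + (n + 1)) x))" for N c
  have "\<exists>c. good N c" for N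
  proof (cases "\<exists>n>0. N = 2 * (n * n + n + 1)")
    case False
    have depth0: "circuit_depth [Konst False] = 0"
      by (simp add: circuit_depth_def gate_depths_def)
    have size: "circuit_size [Konst False] \<le> (8 * N) ^ 21" if "N \<ge> 3"
      unfolding circuit_size_def using one_le_power[of "8 * N" 21] that by simp
    have depth: "real (circuit_depth [Konst False]) \<le> 2500 * ln (real N) ^ 3" if "N \<ge> 3"
      unfolding depth0 using that by simp
    have wf: "wf_circuit N [Konst False]" by (simp add: wf_circuit_def)
    have out: "\<not> circuit_output [Konst False] x" for x
      by (simp add: circuit_output_def gate_vals_def)
    have "good N [Konst False]" unfolding good_def using size depth wf out False by blast
    then show ?thesis by blast
  next
    case True
    then obtain n where n: "n > 0" and N: "N = 2 * (n * n + n + 1)" by blast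
    obtain L where L: "n \<le> 2 ^ L" "2 ^ L \<le> 2 * n" using ex_tight_power_of_two[OF n] .
    obtain c where c: "wf_circuit N c" "circuit_size c \<le> 2 ^ (21 * (L + 3))"
      "circuit_depth c \<le> 20 * (L + 3) ^ 3"
      "\<And>x. circuit_output c x = same_closed_walks_bits n (n + 1) (n * n + n + 1 + (n + 1)) x"
      by (rule same_closed_walks_circuit[OF n L N]) blast
    have "1 * 1 \<le> n * n" using n by (intro mult_le_mono) auto
    moreover have "N = 2 * (n * n) + 2 * n + 2" by (simp add: N)
    ultimately have N6: "6 \<le> N" using n by linarith
    have LN: "2 ^ L \<le> N" using L(2) unfolding N by simp
    have "(2::nat) ^ (L + 3) = 8 * 2 ^ L" by (simp add: power_add)
    then have "(2::nat) ^ (21 * (L + 3)) = (8 * 2 ^ L) ^ 21"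
      by (simp only: mult.commute[of 21] power_mult)
    also have "\<dots> \<le> (8 * N) ^ 21" using LN by (intro power_mono) auto
    finally have "(2::nat) ^ (21 * (L + 3)) \<le> (8 * N) ^ 21" .
    then have size: "circuit_size c \<le> (8 * N) ^ 21" by (rule le_trans[OF c(2)])
    have "real (2 ^ L) \<le> real N" using LN by (rule of_nat_mono)
    then have "ln (2 ^ L) \<le> ln (real N)" using N6 by (subst ln_le_cancel_iff) simp_all
    then have LlnN: "real L * ln 2 \<le> ln (real N)" by (simp add: ln_realpow)
    have "exp 1 \<le> (4::real)" using exp_le by linarith
    then have "1 \<le> ln (4::real)" by (subst ln_ge_iff) auto
    moreover have "ln (4::real) = 2 * ln 2" using ln_realpow[of 2 2] by simp
    ultimately have ln2: "1 / 2 \<le> ln (2::real)" by linarith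
    have "exp 1 \<le> real N" using exp_le N6 by linarith
    then have lnN: "1 \<le> ln (real N)" using N6 by (subst ln_ge_iff) auto
    \<comment> \<open>\<open>L + 3 \<le> 2 * ln N + 3 * ln N\<close>, and \<open>20 * 5 ^ 3 = 2500\<close>.\<close>
    have "real L * (1 / 2) \<le> real L * ln 2" using ln2 by (rule mult_left_mono) simp
    then have "real (L + 3) \<le> 5 * ln (real N)" using LlnN lnN by simp
    then have "real (L + 3) ^ 3 \<le> (5 * ln (real N)) ^ 3" by (rule power_mono) simp
    moreover have "real (circuit_depth c) \<le> real (20 * (L + 3) ^ 3)" using c(3) by (rule of_nat_mono)
    ultimately have depth: "real (circuit_depth c) \<le> 2500 * ln (real N) ^ 3"
      by (simp add: power_mult_distrib)
    have uniq: "m = n" if "N = 2 * (m * m + m + 1)" for m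
      by (rule input_length_inj) (use that N in simp)
    have out: "\<forall>m>0. N = 2 * (m * m + m + 1) \<longrightarrow>
        (\<forall>x. circuit_output c x \<longleftrightarrow> same_closed_walks_bits m (m + 1) (m * m + m + 1 + (m + 1)) x)"
    proof (intro allI impI)
      fix m x assume "N = 2 * (m * m + m + 1)"
      then have mn: "m = n" by (rule uniq)
      show "circuit_output c x \<longleftrightarrow> same_closed_walks_bits m (m + 1) (m * m + m + 1 + (m + 1)) x"
        unfolding mn by (rule c(4))
    qed
    have "\<not> (\<forall>n>0. N \<noteq> 2 * (n * n + n + 1))" using n N by blast
    then have "good N c" unfolding good_def using c(1) size depth out by (simp only: simp_thms)
    then show ?thesis by blast
  qed
  then have "\<forall>N. \<exists>c. good N c" by blast
  then have "\<exists>C. \<forall>N. good N (C N)" by (rule choice)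
  then obtain C where "\<forall>N. good N (C N)" by blast
  then have C: "good N (C N)" for N by blast
  show ?thesis
  proof (rule that[of C])
    show "wf_circuit N (C N)" for N using C[of N] unfolding good_def by blast
    show "circuit_size (C N) \<le> (8 * N) ^ 21" if "N \<ge> 3" for N
      using C[of N] that unfolding good_def by blast
    show "real (circuit_depth (C N)) \<le> 2500 * ln (real N) ^ 3" if "N \<ge> 3" for N
      using C[of N] that unfolding good_def by blast
    show "\<not> circuit_output (C N) x" if "\<And>n. n > 0 \<Longrightarrow> N \<noteq> 2 * (n * n + n + 1)" for N x
      using C[of N] that unfolding good_def by blast
    show "circuit_output (C (2 * (n * n + n + 1))) x \<longleftrightarrow>
       same_closed_walks_bits n (n + 1) (n * n + n + 1 + (n + 1)) x" if "n > 0" for n x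
      using C[of "2 * (n * n + n + 1)"] that unfolding good_def by blast
  qed
qed


section \<open>Deciding isomorphism\<close>

lemma nth_concat_rows:
  fixes f :: "nat \<Rightarrow> nat \<Rightarrow> 'a" and n :: nat
  defines "rows \<equiv> \<lambda>m. concat (map (\<lambda>u. map (f u) [0..<n]) [0..<m])"
  shows "length (rows m) = m * n" and "u < m \<Longrightarrow> v < n \<Longrightarrow> rows m ! (u * n + v) = f u v"
proof -
  show len: "length (rows m) = m * n" for m
    by (induction m) (simp_all add: rows_def)
  show "u < m \<Longrightarrow> v < n \<Longrightarrow> rows m ! (u * n + v) = f u v"
  proof (induction m)
    case (Suc m)
    have snoc: "rows (Suc m) = rows m @ map (f m) [0..<n]" by (simp add: rows_def)
    show ?case
    proof (cases "u = m")
      case True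
      then show ?thesis using Suc.prems len[of m] by (simp add: snoc nth_append)
    next
      case False
      then have "Suc u * n \<le> m * n" using Suc.prems by (intro mult_le_mono1) simp
      then have "u * n + v < length (rows m)" using Suc.prems len[of m] by simp
      then show ?thesis using Suc False by (simp add: snoc nth_append)
    qed
  qed simp
qed

lemma encode_digraph:
  assumes "card (pverts G) = n"
  shows "length (encode_digraph G) = n * n + n + 1"
    and "i < n \<Longrightarrow> encode_digraph G ! i"
    and "\<not> encode_digraph G ! n"
    and "u < n \<Longrightarrow> v < n \<Longrightarrow> encode_digraph G ! (n + 1 + u * n + v) = arc G u v"
proof -
  let ?rows = "concat (map (\<lambda>u. map (arc G u) [0..<n]) [0..<n])"
  have e: "encode_digraph G = replicate n True @ False # ?rows"
    using assms by (simp add: encode_digraph_def)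
  show "length (encode_digraph G) = n * n + n + 1"
    by (simp only: e length_append list.size nth_concat_rows(1) length_replicate)
  show "i < n \<Longrightarrow> encode_digraph G ! i" and "\<not> encode_digraph G ! n"
    by (simp_all add: e nth_append)
  show "encode_digraph G ! (n + 1 + u * n + v) = arc G u v" if "u < n" "v < n"
    using nth_concat_rows(2)[OF that, of "arc G"] by (simp add: e nth_append)
qed

lemma same_closed_walks_bits_encode:
  assumes G: "input_digraph G" and H: "input_digraph H"
    and n: "card (pverts G) = n" "card (pverts H) = n"
  shows "same_closed_walks_bits n (n + 1) (n * n + n + 1 + (n + 1)) (encode_digraph G @ encode_digraph H) \<longleftrightarrow>
    (\<forall>k \<le> 2 * n. closed_walks (pverts G) (arc G) k = closed_walks (pverts H) (arc H) k)"
proof -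
  let ?x = "encode_digraph G @ encode_digraph H"
  have verts: "pverts G = {..<n}" "pverts H = {..<n}" using G H n by (simp_all add: input_digraph_def)
  note eG = encode_digraph[OF n(1)] and eH = encode_digraph[OF n(2)]
  have in_range: "n + 1 + u * n + v < n * n + n + 1" if "u < n" "v < n" for u v
  proof -
    have "Suc u * n \<le> n * n" using that by (intro mult_le_mono1) simp
    then show ?thesis using that by simp
  qed
  have "closed_walks {..<n} (bit_arc n (n + 1) ?x) k = closed_walks (pverts G) (arc G) k" for k
    unfolding verts
    by (rule closed_walks_iso[of id])
       (use in_range eG in \<open>auto simp: bit_arc_def nth_append\<close>)
  moreover have "closed_walks {..<n} (bit_arc n (n * n + n + 1 + (n + 1)) ?x) k = closed_walks (pverts H) (arc H) k" for k
  proof (unfold verts, rule closed_walks_iso[of id])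
    fix u v assume "u \<in> {..<n}" "v \<in> {..<n}"
    then have "encode_digraph H ! (n + 1 + u * n + v) = arc H u v" using eH(4) by simp
    moreover have "?x ! (length (encode_digraph G) + (n + 1 + u * n + v)) = encode_digraph H ! (n + 1 + u * n + v)"
      by (rule nth_append_length_plus)
    ultimately show "bit_arc n (n * n + n + 1 + (n + 1)) ?x u v = arc H (id u) (id v)"
      by (simp add: bit_arc_def eG(1) add.assoc)
  qed simp
  moreover have "?x ! i" if "i < n" for i using eG that by (simp add: nth_append)
  moreover have "\<not> ?x ! n" using eG by (simp add: nth_append)
  ultimately show ?thesis unfolding same_closed_walks_bits_def by simp
qed

text \<open>
  The unary code of the order ends with the first bit \<open>False\<close>, so the test of the first \<open>m + 1\<close> bits fails.
\<close>

lemma not_same_closed_walks_bits_encode: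
  assumes n: "card (pverts G) = n" and m: "m \<noteq> n"
  shows "\<not> same_closed_walks_bits m a b (encode_digraph G @ encode_digraph H)"
proof -
  note eG = encode_digraph[OF n]
  show ?thesis
  proof (cases "m < n")
    case True
    then show ?thesis using eG by (auto simp: same_closed_walks_bits_def nth_append)
  next
    case False
    then have "n < m" using m by simp
    moreover have "\<not> (encode_digraph G @ encode_digraph H) ! n" using eG by (simp add: nth_append)
    ultimately show ?thesis by (auto simp: same_closed_walks_bits_def)
  qed
qed

text \<open>
  Two orders \<open>n \<noteq> m\<close> may produce the same input length as two equal orders \<open>k\<close>. Then \<open>k \<noteq> n\<close>, and the
  test of the leading bits rejects the input.
\<close>

lemma iso_instance_circuit_output:
  assumes C0: "\<And>N x. (\<And>n. n > 0 \<Longrightarrow> N \<noteq> 2 * (n * n + n + 1)) \<Longrightarrow> \<not> circuit_output (C N) x"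
    and C1: "\<And>n x. n > 0 \<Longrightarrow> circuit_output (C (2 * (n * n + n + 1))) x \<longleftrightarrow>
       same_closed_walks_bits n (n + 1) (n * n + n + 1 + (n + 1)) x"
    and x: "x \<in> iso_instances b conn_circulant_prime_power"
  shows "circuit_output (C (length x)) x \<longleftrightarrow> b"
proof -
  obtain G H where x: "x = encode_digraph G @ encode_digraph H"
    and K: "G \<in> conn_circulant_prime_power" "H \<in> conn_circulant_prime_power"
    and input: "input_digraph G" "input_digraph H"
    and b: "digraph_iso (with_proj G) (with_proj H) = b"
    using x unfolding iso_instances_def by blast
  have pd: "pair_digraph G" "pair_digraph H" using input by (simp_all add: input_digraph_def)
  define n m where "n = card (pverts G)" and "m = card (pverts H)"
  have len: "length x = (n * n + n + 1) + (m * m + m + 1)"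
    using encode_digraph(1)[of G n] encode_digraph(1)[of H m] by (simp add: x n_def m_def)
  show ?thesis
  proof (cases "n = m")
    case True
    have "n > 0"
    proof -
      interpret G: pair_digraph G by fact
      have "Digraph_Component.connected (with_proj G)"
        using K(1) unfolding conn_circulant_prime_power_def by blast
      then have "pverts G \<noteq> {}"
        unfolding connected_def strongly_connected_def with_proj_simps pverts_mk_symmetric by blast
      then show ?thesis unfolding n_def using G.pair_finite_verts by (auto simp: card_gt_0_iff)
    qed
    moreover have "length x = 2 * (n * n + n + 1)" using len True by simp
    ultimately have "circuit_output (C (length x)) x \<longleftrightarrow>
        (\<forall>k \<le> 2 * n. closed_walks (pverts G) (arc G) k = closed_walks (pverts H) (arc H) k)"
      using C1[of n x] same_closed_walks_bits_encode[OF input, of n] True by (simp add: x n_def m_def)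
    then show ?thesis
      using conn_circulant_iso_iff_closed_walks[OF K(1) pd(1) K(2) pd(2), of n] b True
      by (simp add: n_def m_def)
  next
    case False
    have "\<not> b"
    proof
      assume "b"
      then obtain f where "bij_betw f (pverts G) (pverts H)"
        using b digraph_iso_with_projE[of G H] by blast
      then show False using False bij_betw_same_card unfolding n_def m_def by blast
    qed
    moreover have "\<not> circuit_output (C (length x)) x"
    proof (cases "\<exists>k>0. length x = 2 * (k * k + k + 1)")
      case True
      then obtain k where k: "k > 0" "length x = 2 * (k * k + k + 1)" by blast
      have "k \<noteq> n"
      proof
        assume "k = n"
        then have "m * m + m + 1 = n * n + n + 1" using len k(2) by simp
        then show False using input_length_inj[of m n] \<open>n \<noteq> m\<close> by simp
      qed
      then show ?thesis
        unfolding k(2) C1[OF k(1)] unfolding x by (rule not_same_closed_walks_bits_encode[OF n_def[symmetric]])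
    qed (use C0 in blast)
    ultimately show ?thesis by simp
  qed
qed

theorem corollary3:
  shows "isomorphism_problem_in_NC conn_circulant_prime_power"
proof -
  obtain C where wf: "\<And>N. wf_circuit N (C N)"
    and size: "\<And>N. N \<ge> 3 \<Longrightarrow> circuit_size (C N) \<le> (8 * N) ^ 21"
    and depth: "\<And>N. N \<ge> 3 \<Longrightarrow> real (circuit_depth (C N)) \<le> 2500 * ln (real N) ^ 3"
    and C0: "\<And>N x. (\<And>n. n > 0 \<Longrightarrow> N \<noteq> 2 * (n * n + n + 1)) \<Longrightarrow> \<not> circuit_output (C N) x"
    and C1: "\<And>n x. n > 0 \<Longrightarrow> circuit_output (C (2 * (n * n + n + 1))) x \<longleftrightarrow>
       same_closed_walks_bits n (n + 1) (n * n + n + 1 + (n + 1)) x"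
    by (rule same_closed_walks_circuit_family) blast
  have size': "(\<lambda>N. real (circuit_size (C N))) \<in> O(\<lambda>N. real N ^ 21)"
  proof (rule bigoI[of _ "8 ^ 21"], rule eventually_mono[OF eventually_ge_at_top[of 3]])
    fix N :: nat assume "N \<ge> 3"
    then have "real (circuit_size (C N)) \<le> real ((8 * N) ^ 21)" by (intro of_nat_mono size)
    then show "norm (real (circuit_size (C N))) \<le> 8 ^ 21 * norm (real N ^ 21)"
      by (simp add: power_mult_distrib)
  qed
  have depth': "(\<lambda>N. real (circuit_depth (C N))) \<in> O(\<lambda>N. ln (real N) ^ 3)"
  proof (rule bigoI[of _ 2500], rule eventually_mono[OF eventually_ge_at_top[of 3]])
    fix N :: nat assume "N \<ge> 3"
    then show "norm (real (circuit_depth (C N))) \<le> 2500 * norm (ln (real N) ^ 3)"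
      using depth[of N] by simp
  qed
  show ?thesis
    unfolding isomorphism_problem_in_NC_def decidable_in_NC_def
    using wf size' depth' iso_instance_circuit_output[of C, OF C0 C1] by blast
qed

end
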